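(* Let $q\ge 0$ be an integer, let $\xi$ be real with $-1<\xi<1$, and let $\lambda, s$ be complex numbers such that $\Re\lambda>0$ and $-q-1<\Re s<-q$. Let $$h(u)=-\left(1+2u\xi+u^2\right)^{-\lambda}+\sum_{j=0}^{q}(-u)^j G_j^{\lambda}(\xi),\qquad 0<u<\infty,$$ where $G_j^\lambda$ are the Gegenbauer polynomials. Then the Mellin transform of $h$ is $$M(h,s)=\int_0^\infty h(u)\,u^{s-1}\,du=-\frac{\sqrt{\pi}\,\Gamma(s)\,\Gamma(2\lambda-s)}{2^{\lambda-1/2}\,\Gamma(\lambda)}\left(1-\xi^2\right)^{\frac{1-2\lambda}{4}}P^{1/2-\lambda}_{s-\lambda-1/2}(\xi),$$ where $P^\mu_\nu(\xi)$ is the associated Legendre function of the first kind on the cut $(-1,1)$.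
   Context: $\Gamma$ is Euler's Gamma function. Complex powers of positive real numbers are taken with the real logarithm (note $1+2u\xi+u^2>0$ for $u>0$, $-1<\xi<1$). The Gegenbauer polynomials $G_j^\lambda(\xi)$, $j=0,1,2,\ldots$, are defined by the generating function $(1+2t\xi+t^2)^{-\lambda}=\sum_{j=0}^\infty(-t)^jG_j^\lambda(\xi)$ for $|t|<1$, $-1\le\xi\le1$. The associated Legendre function of the first kind on the cut, with complex parameters $\mu,\nu$, is the solution of $(1-\xi^2)y''-2\xi y'+[\nu(\nu+1)-\mu^2(1-\xi^2)^{-1}]y=0$ on $-1<\xi<1$ given by (Bateman–Erdélyi convention) $$P^\mu_\nu(\xi)=\frac{1}{\Gamma(1-\mu)}\left(\frac{1+\xi}{1-\xi}\right)^{\mu/2}{}_2F_1\!\left(-\nu,\nu+1;1-\mu;\frac{1-\xi}{2}\right),$$ where ${}_2F_1$ is the Gauss hypergeometric function. *)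

theory Defs
  imports "HOL-Complex_Analysis.Complex_Analysis"
begin

text \<open>The sequence of Gegenbauer coefficients at a point \<open>\<xi>\<close> is characterised by the generating
  function for real \<open>t\<close>. The description is proper for
  \<open>-1 \<le> \<xi> \<le> 1\<close>, see \<open>gegenbauer_sums\<close> and \<open>gegenbauer_unique\<close> below.\<close>

definition gegenbauer :: "nat \<Rightarrow> complex \<Rightarrow> real \<Rightarrow> complex" where
  "gegenbauer j l \<xi> =
     (THE G :: nat \<Rightarrow> complex. \<forall>t::real. \<bar>t\<bar> < 1 \<longrightarrow>
        (\<lambda>k. (- complex_of_real t) ^ k * G k) sums
          (complex_of_real (1 + 2 * t * \<xi> + t\<^sup>2) powr (- l))) j"

lemma gegenbauer_ex:
  fixes l :: complex and \<xi> :: real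
  assumes "-1 \<le> \<xi>" "\<xi> \<le> 1"
  shows "\<exists>G :: nat \<Rightarrow> complex. \<forall>t::real. \<bar>t\<bar> < 1 \<longrightarrow>
           (\<lambda>k. (- complex_of_real t) ^ k * G k) sums
             (complex_of_real (1 + 2 * t * \<xi> + t\<^sup>2) powr (- l))"
proof -
  define w where "w = Complex \<xi> (sqrt (1 - \<xi>\<^sup>2))"
  have x2: "\<xi>\<^sup>2 \<le> 1" using assms by (simp add: abs_square_le_1 abs_le_iff)
  have w1: "norm w = 1" using x2 by (simp add: w_def complex_norm)
  define F where "F = (\<lambda>z. exp (- l * (Ln (1 + z * w) + Ln (1 + z * cnj w))))"
  have pos: "Re (1 + z * v) > 0" if "norm z < 1" "norm v = 1" for z v :: complex
  proof -
    have "\<bar>Re (z * v)\<bar> \<le> norm (z * v)" by (rule abs_Re_le_cmod)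
    also have "\<dots> < 1" using that by (simp add: norm_mult)
    finally show ?thesis by simp
  qed
  have notneg: "1 + z * v \<notin> \<real>\<^sub>\<le>\<^sub>0" if "norm z < 1" "norm v = 1" for z v :: complex
    using pos[OF that] by (auto simp: complex_nonpos_Reals_iff)
  have hol: "F holomorphic_on ball 0 1"
    unfolding F_def using w1 by (intro holomorphic_intros notneg) auto
  define a where "a = (\<lambda>n. (deriv ^^ n) F 0 / fact n)"
  have sums: "(\<lambda>n. a n * z ^ n) sums F z" if "norm z < 1" for z
    using holomorphic_power_series[OF hol, of z] that by (simp add: a_def)
  have Fval: "F (of_real t) = complex_of_real (1 + 2 * t * \<xi> + t\<^sup>2) powr (- l)"
    if t: "\<bar>t\<bar> < 1" for t :: real
  proof -
    define v where "v = 1 + of_real t * w"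
    have v0: "Re v > 0" unfolding v_def using pos[of "of_real t" w] t w1 by simp
    then have vne: "v \<noteq> 0" by auto
    have vn: "v \<notin> \<real>\<^sub>\<le>\<^sub>0" using v0 by (auto simp: complex_nonpos_Reals_iff)
    have "(norm v)\<^sup>2 = (1 + t * \<xi>)\<^sup>2 + t\<^sup>2 * (1 - \<xi>\<^sup>2)"
      using x2 by (simp add: v_def w_def cmod_power2 power_mult_distrib)
    then have nv: "(norm v)\<^sup>2 = 1 + 2 * t * \<xi> + t\<^sup>2"
      by (simp add: power2_eq_square algebra_simps)
    have "Ln v + Ln (cnj v) = Ln v + cnj (Ln v)"
      using cnj_Ln[OF vn] by simp
    also have "\<dots> = of_real (2 * ln (norm v))"
      using vne by (simp add: complex_add_cnj)
    also have "2 * ln (norm v) = ln ((norm v)\<^sup>2)"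
      using vne by (simp add: ln_realpow)
    finally have e: "Ln v + Ln (cnj v) = of_real (ln (1 + 2 * t * \<xi> + t\<^sup>2))"
      using nv by simp
    have p: "1 + 2 * t * \<xi> + t\<^sup>2 > 0" using nv vne by (metis zero_less_norm_iff zero_less_power)
    have "F (of_real t) = exp (- l * (Ln v + Ln (cnj v)))"
      by (simp add: F_def v_def)
    also have "\<dots> = complex_of_real (1 + 2 * t * \<xi> + t\<^sup>2) powr (- l)"
      unfolding e powr_def using p Ln_of_real[OF p] by (simp del: of_real_add of_real_mult of_real_power)
    finally show ?thesis .
  qed
  show ?thesis
  proof (intro exI allI impI)
    fix t :: real assume t: "\<bar>t\<bar> < 1"
    have "(- complex_of_real t) ^ k * ((-1) ^ k * a k) = a k * of_real t ^ k" for k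
    proof -
      have "(- complex_of_real t) ^ k * (-1) ^ k = of_real t ^ k"
        by (simp add: power_mult_distrib[symmetric])
      then show ?thesis by (simp add: mult.assoc[symmetric])
    qed
    then have e: "(\<lambda>k. (- complex_of_real t) ^ k * ((-1) ^ k * a k)) = (\<lambda>k. a k * of_real t ^ k)"
      by blast
    have n: "norm (complex_of_real t) < 1" using t by simp
    show "(\<lambda>k. (- complex_of_real t) ^ k * ((-1) ^ k * a k)) sums
             (complex_of_real (1 + 2 * t * \<xi> + t\<^sup>2) powr (- l))"
      unfolding e Fval[OF t, symmetric] by (rule sums[OF n])
  qed
qed

lemma powser_real_zero:
  fixes d :: "nat \<Rightarrow> complex"
  assumes "\<And>t::real. \<bar>t\<bar> < 1 \<Longrightarrow> (\<lambda>k. (- complex_of_real t) ^ k * d k) sums 0"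
  shows "d n = 0"
proof (rule ccontr)
  assume dn: "d n \<noteq> 0"
  have r: "(\<lambda>k. d k * complex_of_real t ^ k) sums 0" if "\<bar>t\<bar> < 1" for t
    using assms[of "- t"] that by (simp add: mult.commute)
  have d0: "d 0 = 0" using r[of 0] powser_sums_zero_iff[of d 0] by simp
  define f where "f = (\<lambda>z. \<Sum>k. d k * z ^ k)"
  have s: "(\<lambda>k. d k * (z - 0) ^ k) sums f z" if "norm (z - 0) < 1/2" for z
  proof -
    have "summable (\<lambda>k. d k * z ^ k)"
      by (rule powser_inside[of _ "of_real (1/2)"])
        (use r[of "1/2"] that in \<open>auto simp: sums_iff\<close>)
    then show ?thesis by (simp add: f_def summable_sums)
  qed
  have f0: "f (of_real t) = 0" if "\<bar>t\<bar> < 1" for t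
    using r[OF that] by (simp add: f_def sums_iff)
  have n0: "n > 0" using dn d0 by (cases n) auto
  obtain e where e: "0 < e" "\<And>z. z \<in> cball 0 e - {0} \<Longrightarrow> f z \<noteq> 0"
    using powser_0_nonzero[of "1/2" 0 d f n] s f0[of 0] dn n0 by (simp) blast
  have "f (of_real (min e (1/2))) = 0" using e(1) by (intro f0) auto
  moreover have "f (of_real (min e (1/2))) \<noteq> 0" using e(1) by (intro e(2)) auto
  ultimately show False by blast
qed

lemma gegenbauer_unique:
  fixes G :: "nat \<Rightarrow> complex"
  assumes "\<And>t::real. \<bar>t\<bar> < 1 \<Longrightarrow> (\<lambda>k. (- complex_of_real t) ^ k * G k) sums
             (complex_of_real (1 + 2 * t * \<xi> + t\<^sup>2) powr (- l))"
  shows "gegenbauer j l \<xi> = G j"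
proof -
  have "H = G" if H: "\<forall>t::real. \<bar>t\<bar> < 1 \<longrightarrow> (\<lambda>k. (- complex_of_real t) ^ k * H k) sums
             (complex_of_real (1 + 2 * t * \<xi> + t\<^sup>2) powr (- l))" for H
  proof
    fix n
    have "(\<lambda>k. H k - G k) n = 0"
    proof (rule powser_real_zero)
      fix t :: real assume "\<bar>t\<bar> < 1"
      then show "(\<lambda>k. (- complex_of_real t) ^ k * (H k - G k)) sums 0"
        using sums_diff[OF H[rule_format, of t] assms[of t]] by (simp add: right_diff_distrib)
    qed
    then show "H n = G n" by simp
  qed
  then show ?thesis
    unfolding gegenbauer_def by (subst the_equality[of _ G]) (use assms in blast)+
qed

lemma gegenbauer_sums:
  fixes t :: real
  assumes "-1 \<le> \<xi>" "\<xi> \<le> 1" "\<bar>t\<bar> < 1"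
  shows "(\<lambda>k. (- complex_of_real t) ^ k * gegenbauer k l \<xi>) sums
           (complex_of_real (1 + 2 * t * \<xi> + t\<^sup>2) powr (- l))"
proof -
  obtain G where G: "\<And>t::real. \<bar>t\<bar> < 1 \<Longrightarrow> (\<lambda>k. (- complex_of_real t) ^ k * G k) sums
             (complex_of_real (1 + 2 * t * \<xi> + t\<^sup>2) powr (- l))"
    using gegenbauer_ex[OF assms(1,2), of l] by blast
  show ?thesis using G[OF assms(3)] gegenbauer_unique[OF G] by simp
qed

text \<open>The series of \<open>\<^sub>2F\<^sub>1\<close>, which represents the Gauss function for \<open>|z| < 1\<close> (and \<open>c\<close> not a
  non-positive integer); below it is only needed for \<open>z = (1 - \<xi>) / 2 \<in> (0, 1)\<close>.\<close>

definition hyp2F1 :: "complex \<Rightarrow> complex \<Rightarrow> complex \<Rightarrow> complex \<Rightarrow> complex" where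
  "hyp2F1 a b c z = eval_fps (fps_hypergeo [a, b] [c] 1) z"

definition legendreP :: "complex \<Rightarrow> complex \<Rightarrow> real \<Rightarrow> complex" where
  "legendreP \<mu> \<nu> \<xi> =
     1 / Gamma (1 - \<mu>) * complex_of_real ((1 + \<xi>) / (1 - \<xi>)) powr (\<mu> / 2) *
     hyp2F1 (- \<nu>) (\<nu> + 1) (1 - \<mu>) (complex_of_real ((1 - \<xi>) / 2))"

definition mellin_integrand :: "(real \<Rightarrow> complex) \<Rightarrow> complex \<Rightarrow> real \<Rightarrow> complex" where
  "mellin_integrand h s u = h u * complex_of_real u powr (s - 1)"

text \<open>Bochner integrals default to \<open>0\<close>, so a value of \<open>mellin\<close> is only meaningful together
  with \<open>mellin_exists\<close>.\<close>

definition mellin_exists :: "(real \<Rightarrow> complex) \<Rightarrow> complex \<Rightarrow> bool" where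
  "mellin_exists h s \<longleftrightarrow> set_integrable lborel {0<..} (mellin_integrand h s)"

definition mellin :: "(real \<Rightarrow> complex) \<Rightarrow> complex \<Rightarrow> complex" where
  "mellin h s = (LINT u:{0<..}|lborel. mellin_integrand h s u)"

definition gegenbauer_remainder :: "nat \<Rightarrow> complex \<Rightarrow> real \<Rightarrow> real \<Rightarrow> complex" where
  "gegenbauer_remainder q l \<xi> u =
     - (complex_of_real (1 + 2 * u * \<xi> + u\<^sup>2) powr (- l)) +
     (\<Sum>j=0..q. (- complex_of_real u) ^ j * gegenbauer j l \<xi>)"

end

theory Submission
  imports Defs
begin

text \<open>With \<open>z = (1 - \<xi>) / 2\<close> one has \<open>1 + 2 u \<xi> + u\<^sup>2 = (1 + u)\<^sup>2 - 4 u z\<close>, and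
  \<open>4 u \<le> (1 + u)\<^sup>2\<close>, so the binomial series in powers of \<open>4 u z / (1 + u)\<^sup>2\<close> converges for every
  \<open>u > 0\<close>, dominated by the binomial series in \<open>z < 1\<close>, which does not depend on \<open>u\<close>. Its \<open>n\<close>-th term is a
  multiple of \<open>u ^ n (1 + u) powr (- 2 l - 2 n)\<close>; removing from each term its Taylor polynomial of
  degree \<open>q\<close> at \<open>0\<close> removes from the sum the Gegenbauer polynomials, since both remainders are
  \<open>O(u ^ (q + 1))\<close>. The Mellin transform of the \<open>n\<close>-th term is the Beta integral, continued to the
  strip \<open>-q - 1 < Re s < -q\<close> by partial integration, and the sum over \<open>n\<close> is a hypergeometric series.
  Euler's transformation and the duplication formula turn it into the Legendre function.\<close>

subsection \<open>Mellin transforms and the Beta integral\<close>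

text \<open>A Bochner integral that does not exist still has the value 0, so existence and value
  travel together, and linearity or substitution acts on both at once.\<close>

definition has_mellin :: "(real \<Rightarrow> complex) \<Rightarrow> complex \<Rightarrow> complex \<Rightarrow> bool" where
  "has_mellin h s v \<longleftrightarrow>
     has_bochner_integral lborel (\<lambda>u. indicator {0<..} u *\<^sub>R mellin_integrand h s u) v"

lemma has_mellin_iff: "has_mellin h s v \<longleftrightarrow> mellin_exists h s \<and> mellin h s = v"
  by (simp add: has_mellin_def mellin_exists_def mellin_def set_integrable_def
      set_lebesgue_integral_def has_bochner_integral_iff)

lemma mellin_existsD:
  "mellin_exists h s \<Longrightarrow> integrable lborel (\<lambda>u. indicator {0<..} u *\<^sub>R mellin_integrand h s u)"
  by (simp add: mellin_exists_def set_integrable_def)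

lemma mellin_exists_bound:
  assumes "mellin_exists g s" and "continuous_on {0<..} h"
    and "\<And>u. u > 0 \<Longrightarrow> norm (h u) \<le> norm (g u)"
  shows "mellin_exists h s"
  unfolding mellin_exists_def set_integrable_def
proof (rule Bochner_Integration.integrable_bound[OF mellin_existsD[OF assms(1)]])
  have "continuous_on {0<..} (mellin_integrand h s)"
    unfolding mellin_integrand_def using assms(2)
    by (intro continuous_intros) (auto simp: complex_nonpos_Reals_iff)
  then show "(\<lambda>u. indicator {0<..} u *\<^sub>R mellin_integrand h s u) \<in> borel_measurable lborel"
    by (simp add: borel_measurable_continuous_on_indicator)
  show "AE u in lborel. norm (indicator {0<..} u *\<^sub>R mellin_integrand h s u)
          \<le> norm (indicator {0<..} u *\<^sub>R mellin_integrand g s u)"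
    using assms(3) by (auto simp: mellin_integrand_def norm_mult mult_right_mono split: split_indicator)
qed

lemma has_mellin_mult_power:
  assumes "has_mellin h (s + of_nat n) v"
  shows "has_mellin (\<lambda>u. c * of_real u ^ n * h u) s (c * v)"
proof -
  have "has_bochner_integral lborel
      (\<lambda>u. c * (indicator {0<..} u *\<^sub>R mellin_integrand h (s + of_nat n) u)) (c * v)"
    using assms unfolding has_mellin_def by (rule has_bochner_integral_mult_right)
  moreover have "c * (indicator {0<..} u *\<^sub>R mellin_integrand h (s + of_nat n) u) =
      indicator {0<..} u *\<^sub>R mellin_integrand (\<lambda>u. c * of_real u ^ n * h u) s u" for u
  proof (cases "u > 0")
    case True
    have "complex_of_real u powr (s + of_nat n - 1) = of_real u powr (s - 1) * of_real u powr (of_nat n)"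
      by (simp add: algebra_simps flip: powr_add)
    also have "complex_of_real u powr (of_nat n) = of_real u ^ n"
      using True by (intro powr_complexpow) auto
    finally show ?thesis using True
      by (simp add: mellin_integrand_def mult_ac)
  qed simp
  ultimately show ?thesis by (simp only: has_mellin_def)
qed

lemma norm_of_real_powr: "u > 0 \<Longrightarrow> norm (complex_of_real u powr z) = u powr Re z"
  by (simp add: norm_powr_real_powr)

lemma has_mellin_exp:
  assumes s: "Re s > 0" and t: "t > 0"
  shows "has_mellin (\<lambda>u. of_real (exp (- (t * u)))) s (Gamma s * of_real t powr (- s))"
proof -
  define f where "f = (\<lambda>u. complex_of_real u powr (s - 1) / of_real (exp u))"
  have cont: "continuous_on {0<..} f"
    unfolding f_def by (intro continuous_intros) (auto simp: complex_nonpos_Reals_iff)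
  then have [measurable]: "(\<lambda>u. indicator {0<..} u *\<^sub>R f u) \<in> borel_measurable borel"
    by (simp add: borel_measurable_continuous_on_indicator)
  have "set_integrable lebesgue {0<..} f"
    using absolutely_integrable_Gamma_integral'[OF s] by (simp add: f_def)
  then have si: "set_integrable lborel {0<..} f"
    unfolding set_integrable_def by (subst (asm) integrable_completion) simp_all
  have "(LINT u:{0<..}|lborel. f u) = Gamma s"
    using set_borel_integral_eq_integral(2)[OF si] Gamma_integral_complex'[OF s]
    by (simp add: f_def integral_unique)
  with si have "has_bochner_integral lborel (\<lambda>u. indicator {0<..} u *\<^sub>R f u) (Gamma s)"
    by (simp add: has_bochner_integral_iff set_integrable_def set_lebesgue_integral_def)
  then have "has_bochner_integral lborel
      (\<lambda>u. indicator {0<..} (0 + t * u) *\<^sub>R f (0 + t * u)) (Gamma s /\<^sub>R \<bar>t\<bar>)"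
    using t by (subst lborel_has_bochner_integral_real_affine_iff[symmetric]) auto
  \<comment> \<open>The factor \<open>t powr (1 - s)\<close> removes the \<open>t\<close>-part of
    \<open>(t * u) powr (s - 1)\<close>; with the Jacobian \<open>1 / t\<close> it leaves
    \<open>t powr (- s)\<close>.\<close>
  then have "has_bochner_integral lborel
      (\<lambda>u. of_real t powr (1 - s) * (indicator {0<..} (0 + t * u) *\<^sub>R f (0 + t * u)))
      (of_real t powr (1 - s) * (Gamma s /\<^sub>R \<bar>t\<bar>))"
    by (rule has_bochner_integral_mult_right)
  moreover have "of_real t powr (1 - s) * (Gamma s /\<^sub>R \<bar>t\<bar>) = Gamma s * of_real t powr (- s)"
    using t by (simp add: powr_diff powr_minus scaleR_conv_of_real field_simps)
  moreover have "of_real t powr (1 - s) * (indicator {0<..} (0 + t * u) *\<^sub>R f (0 + t * u)) =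
     indicator {0<..} u *\<^sub>R mellin_integrand (\<lambda>u. of_real (exp (- (t * u)))) s u" for u
  proof (cases "u > 0")
    case True
    have "complex_of_real t powr (1 - s) * of_real t powr (s - 1) = 1"
      using t by (simp add: powr_add[symmetric])
    then show ?thesis
      using True t
      by (simp add: mellin_integrand_def f_def powr_times_real exp_minus field_simps)
  next
    case False
    then have "\<not> t * u > 0" using t by (simp add: zero_less_mult_iff)
    with False show ?thesis by simp
  qed
  ultimately show ?thesis by (simp add: has_mellin_def)
qed

text \<open>Taking real parts at real parameters evaluates the integrals of absolute values in the
  Fubini argument for \<open>has_mellin_Beta\<close>.\<close>

lemma has_bochner_integral_real_of_has_mellin:
  assumes "has_mellin h s v" and "\<And>u. u > 0 \<Longrightarrow> h u = of_real (g u)" and "s = of_real x" and "v = of_real w"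
  shows "has_bochner_integral lborel (\<lambda>u. indicator {0<..} u * (g u * u powr (x - 1))) w"
proof -
  have "has_bochner_integral lborel (\<lambda>u. Re (indicator {0<..} u *\<^sub>R mellin_integrand h s u)) (Re v)"
    using assms(1) unfolding has_mellin_def
    by (rule has_bochner_integral_bounded_linear[OF bounded_linear_Re])
  moreover have "Re (indicator {0<..} u *\<^sub>R mellin_integrand h s u) =
      indicator {0<..} u * (g u * u powr (x - 1))" for u
  proof (cases "u > 0")
    case True
    have "complex_of_real u powr (s - 1) = of_real (u powr (x - 1))"
      using powr_of_real[of u "x - 1"] True by (simp add: assms(3))
    then show ?thesis using True by (simp add: mellin_integrand_def assms(2))
  qed simp
  ultimately show ?thesis by (simp only: assms(4) Re_complex_of_real)
qed

lemma has_mellin_Beta: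
  assumes s: "0 < Re s" "Re s < Re a"
  shows "has_mellin (\<lambda>u. (1 + of_real u) powr (- a)) s (Gamma s * Gamma (a - s) / Gamma a)"
proof -
  \<comment> \<open>Fubini for \<open>f t u\<close>, whose integral over \<open>t\<close> is \<open>Gamma a * (1 + u) powr (- a) * u powr (s - 1)\<close>\<close>
  define A where "A = (\<lambda>t. indicator {0<..} t *\<^sub>R (complex_of_real t powr (a - 1) * of_real (exp (- t))))"
  define B where "B = (\<lambda>u. indicator {0<..} u *\<^sub>R (complex_of_real u powr (s - 1)))"
  define f where "f = (\<lambda>t u. A t * B u * of_real (exp (- (t * u))))"
  have "continuous_on {0<..} (\<lambda>t. complex_of_real t powr (a - 1) * of_real (exp (- t)))"
    and "continuous_on {0<..} (\<lambda>u. complex_of_real u powr (s - 1))"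
    by (intro continuous_intros; auto simp: complex_nonpos_Reals_iff)+
  then have [measurable]: "A \<in> borel_measurable borel" "B \<in> borel_measurable borel"
    unfolding A_def B_def by (simp_all add: borel_measurable_continuous_on_indicator)
  have u_int: "has_bochner_integral lborel (\<lambda>u. f t u) (A t * (Gamma s * of_real t powr (- s)))" for t
  proof (cases "t > 0")
    case True
    have "has_bochner_integral lborel
        (\<lambda>u. A t * (indicator {0<..} u *\<^sub>R mellin_integrand (\<lambda>u. of_real (exp (- (t * u)))) s u))
        (A t * (Gamma s * of_real t powr (- s)))"
      using has_mellin_exp[OF s(1) True] unfolding has_mellin_def
      by (rule has_bochner_integral_mult_right)
    then show ?thesis by (simp add: f_def B_def mellin_integrand_def mult_ac)
  qed (simp add: f_def A_def has_bochner_integral_zero)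
  have t_int: "has_bochner_integral lborel (\<lambda>t. f t u) (B u * (Gamma a * of_real (1 + u) powr (- a)))" for u
  proof (cases "u > 0")
    case True
    have "has_bochner_integral lborel
        (\<lambda>t. B u * (indicator {0<..} t *\<^sub>R mellin_integrand (\<lambda>t. of_real (exp (- ((1 + u) * t)))) a t))
        (B u * (Gamma a * of_real (1 + u) powr (- a)))"
      using has_mellin_exp[of a "1 + u"] s True unfolding has_mellin_def
      by (intro has_bochner_integral_mult_right) auto
    moreover have "B u * (indicator {0<..} t *\<^sub>R mellin_integrand (\<lambda>t. of_real (exp (- ((1 + u) * t)))) a t) = f t u" for t
    proof -
      have "exp (- ((1 + u) * t)) = exp (- t) * exp (- (t * u))"
        by (simp add: algebra_simps flip: exp_add)
      then show ?thesis
        by (simp only: mellin_integrand_def f_def A_def of_real_mult) (simp add: mult_ac)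
    qed
    ultimately show ?thesis by simp
  qed (simp add: f_def B_def has_bochner_integral_zero)
  \<comment> \<open>Replacing \<open>s\<close> by \<open>Re s\<close> evaluates the integral of the
    norm exactly. Integrated over \<open>t\<close> it gives a Gamma integral at
    \<open>Re (a - s)\<close>, which is where \<open>Re s < Re a\<close> enters.\<close>
  have n_int: "has_bochner_integral lborel (\<lambda>u. norm (f t u))
      (norm (A t) * (Gamma (Re s) * t powr (- Re s)))" for t
  proof (cases "t > 0")
    case True
    have "has_bochner_integral lborel
       (\<lambda>u. indicator {0<..} u * (exp (- (t * u)) * u powr (Re s - 1))) (Gamma (Re s) * t powr (- Re s))"
      using True s
      by (intro has_bochner_integral_real_of_has_mellin[OF has_mellin_exp[of "of_real (Re s)" t]])
        (use powr_of_real[of t "- Re s"] in \<open>auto simp: Gamma_complex_of_real\<close>)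
    then have "has_bochner_integral lborel
       (\<lambda>u. norm (A t) * (indicator {0<..} u * (exp (- (t * u)) * u powr (Re s - 1))))
       (norm (A t) * (Gamma (Re s) * t powr (- Re s)))"
      by (rule has_bochner_integral_mult_right)
    moreover have "norm (A t) * (indicator {0<..} u * (exp (- (t * u)) * u powr (Re s - 1))) = norm (f t u)" for u
      by (cases "u > 0") (simp_all add: f_def B_def norm_mult norm_of_real_powr)
    ultimately show ?thesis by simp
  qed (simp add: f_def A_def has_bochner_integral_zero)
  have n_int': "integrable lborel (\<lambda>t. \<integral>u. norm (f t u) \<partial>lborel)"
  proof -
    have "has_bochner_integral lborel
       (\<lambda>t. indicator {0<..} t * (exp (- (1 * t)) * t powr (Re (a - s) - 1)))
       (Gamma (Re (a - s)) * 1 powr (- Re (a - s)))"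
      using s by (intro has_bochner_integral_real_of_has_mellin[OF has_mellin_exp[of "of_real (Re (a - s))" 1]])
        (auto simp: Gamma_complex_of_real simp flip: of_real_diff)
    then have "integrable lborel (\<lambda>t. Gamma (Re s) * (indicator {0<..} t * (exp (- (1 * t)) * t powr (Re (a - s) - 1))))"
      by (intro integrable_mult_right) (auto simp: has_bochner_integral_iff)
    moreover have "Gamma (Re s) * (indicator {0<..} t * (exp (- (1 * t)) * t powr (Re (a - s) - 1))) =
       (\<integral>u. norm (f t u) \<partial>lborel)" for t
    proof (cases "t > 0")
      case True
      have "t powr (Re (a - s) - 1) = t powr (Re a - 1) * t powr (- Re s)"
        by (simp add: algebra_simps flip: powr_add)
      then show ?thesis using True
        by (simp add: has_bochner_integral_integral_eq[OF n_int] A_def norm_mult norm_of_real_powr)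
    qed (simp add: f_def A_def)
    ultimately show ?thesis by (simp only:)
  qed
  have prod: "integrable (lborel \<Otimes>\<^sub>M lborel) (case_prod f)"
  proof (rule lborel_pair.Fubini_integrable)
    show "case_prod f \<in> borel_measurable (lborel \<Otimes>\<^sub>M lborel)"
      unfolding f_def by measurable
    show "AE t in lborel. integrable lborel (\<lambda>u. case_prod f (t, u))"
      using u_int by (auto simp: has_bochner_integral_iff)
  qed (use n_int' in simp)
  define g where "g = (\<lambda>u. B u * (Gamma a * of_real (1 + u) powr (- a)))"
  have "integrable lborel (\<lambda>u. \<integral>t. f t u \<partial>lborel)"
    using lborel_pair.integrable_snd[OF prod] .
  then have g1: "integrable lborel g"
    by (simp add: has_bochner_integral_integral_eq[OF t_int] g_def)
  have "integral\<^sup>L lborel g = (\<integral>u. (\<integral>t. f t u \<partial>lborel) \<partial>lborel)"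
    by (simp add: has_bochner_integral_integral_eq[OF t_int] g_def)
  also have "\<dots> = (\<integral>t. (\<integral>u. f t u \<partial>lborel) \<partial>lborel)"
    by (rule lborel_pair.Fubini_integral[OF prod])
  also have "\<dots> = (\<integral>t. A t * (Gamma s * of_real t powr (- s)) \<partial>lborel)"
    by (simp add: has_bochner_integral_integral_eq[OF u_int])
  also have "\<dots> = (\<integral>t. Gamma s * (indicator {0<..} t *\<^sub>R
       mellin_integrand (\<lambda>t. of_real (exp (- (1 * t)))) (a - s) t) \<partial>lborel)"
  proof (rule Bochner_Integration.integral_cong[OF refl])
    fix t :: real
    show "A t * (Gamma s * of_real t powr (- s)) = Gamma s * (indicator {0<..} t *\<^sub>R
       mellin_integrand (\<lambda>t. of_real (exp (- (1 * t)))) (a - s) t)"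
    proof (cases "t > 0")
      case True
      have "complex_of_real t powr (a - s - 1) = of_real t powr (a - 1) * of_real t powr (- s)"
        by (simp add: algebra_simps flip: powr_add)
      then show ?thesis by (simp add: A_def mellin_integrand_def mult_ac)
    qed (simp add: A_def)
  qed
  also have "\<dots> = Gamma s * Gamma (a - s)"
    using has_bochner_integral_mult_right[OF has_mellin_exp[of "a - s" 1, unfolded has_mellin_def], of "Gamma s"] s
    by (auto simp: has_bochner_integral_iff)
  finally have "has_bochner_integral lborel g (Gamma s * Gamma (a - s))"
    using g1 by (simp add: has_bochner_integral_iff)
  then have "has_bochner_integral lborel (\<lambda>u. 1 / Gamma a * g u) (1 / Gamma a * (Gamma s * Gamma (a - s)))"
    by (rule has_bochner_integral_mult_right)
  moreover have "Gamma a \<noteq> 0"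
    using s by (auto simp: Gamma_eq_zero_iff elim!: nonpos_Ints_cases)
  ultimately show ?thesis
    unfolding has_mellin_def by (simp add: g_def B_def mellin_integrand_def mult_ac)
qed

section \<open>Taylor remainders of \<open>(1 + z) powr (- a)\<close> and the continued Beta
  integral\<close>

text \<open>The index \<open>p\<close> counts the subtracted Taylor terms, so their degrees stay
  below \<open>p\<close>. With \<open>p = 0\<close> nothing is subtracted, and the plain Beta
  integral can start the induction on \<open>p\<close>.\<close>

definition binomial_remainder :: "nat \<Rightarrow> complex \<Rightarrow> complex \<Rightarrow> complex" where
  "binomial_remainder p a z = (1 + z) powr (- a) - (\<Sum>j<p. (- a gchoose j) * z ^ j)"

text \<open>By the absorption identity \<open>(j + 1) * (- a gchoose (j + 1)) = - a * (- (a + 1)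
  gchoose j)\<close>, differentiation gives again such a remainder, with one term fewer and
  \<open>a + 1\<close> for \<open>a\<close>. Both inductions on \<open>p\<close> below rest on
  this.\<close>

lemma binomial_remainder_deriv:
  assumes "1 + z \<notin> \<real>\<^sub>\<le>\<^sub>0"
  shows "(binomial_remainder (Suc p) a has_field_derivative - a * binomial_remainder p (a + 1) z)
           (at z within S)"
proof -
  have "((\<lambda>z. (1 + z) powr (- a) - (\<Sum>j<Suc p. (- a gchoose j) * z ^ j)) has_field_derivative
          - a * (1 + z) powr (- a - 1) - (\<Sum>j<Suc p. (- a gchoose j) * (of_nat j * z ^ (j - 1)))) (at z within S)"
    by (rule has_field_derivative_at_within) (use assms in \<open>auto intro!: derivative_eq_intros sum.cong\<close>)
  also have "(\<Sum>j<Suc p. (- a gchoose j) * (of_nat j * z ^ (j - 1))) =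
      (\<Sum>j<p. of_nat (Suc j) * (- a gchoose Suc j) * z ^ j)"
    by (subst sum.lessThan_Suc_shift) (simp add: mult_ac)
  also have "\<dots> = (\<Sum>j<p. - a * ((- (a + 1) gchoose j) * z ^ j))"
    unfolding gbinomial_absorption by (simp add: mult.assoc)
  finally show ?thesis
    unfolding binomial_remainder_def[abs_def]
    by (simp add: right_diff_distrib sum_distrib_left)
qed

lemma continuous_on_binomial_remainder:
  "continuous_on {0<..} (\<lambda>u. binomial_remainder p a (of_real u))"
  unfolding binomial_remainder_def
  by (intro continuous_intros) (auto simp: complex_nonpos_Reals_iff dest: arg_cong[of _ _ Re])

text \<open>Induction on \<open>p\<close> by the mean value bound: the remainder vanishes at 0, and
  on the segment from 0 to \<open>u\<close> its derivative is at most
  \<open>norm a * C * u ^ p\<close>. Since \<open>Re a \<ge> 0\<close> keeps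
  \<open>(1 + u) powr (- Re a)\<close> at most 1, the estimate holds on the whole half-line and not
  only near 0.\<close>

lemma norm_binomial_remainder_le:
  assumes "Re a \<ge> 0"
  shows "\<exists>C\<ge>0. \<forall>u\<ge>0. norm (binomial_remainder p a (of_real u)) \<le> C * u ^ p"
  using assms
proof (induction p arbitrary: a)
  case 0
  have "norm (binomial_remainder 0 a (of_real u)) \<le> 1 * u ^ 0" if "u \<ge> 0" for u
  proof -
    have "norm (complex_of_real (1 + u) powr (- a)) = (1 + u) powr (- Re a)"
      using that norm_of_real_powr[of "1 + u" "- a"] by simp
    also have "\<dots> \<le> (1 + u) powr 0" using that 0 by (intro powr_mono) auto
    finally show ?thesis using that by (simp add: binomial_remainder_def)
  qed
  then show ?case by (intro exI[of _ 1]) auto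
next
  case (Suc p)
  then have "Re (a + 1) \<ge> 0" by simp
  from Suc.IH[OF this] obtain C where C: "C \<ge> 0"
    "\<And>u. u \<ge> 0 \<Longrightarrow> norm (binomial_remainder p (a + 1) (of_real u)) \<le> C * u ^ p" by blast
  have "norm (binomial_remainder (Suc p) a (of_real u)) \<le> (norm a * C) * u ^ Suc p" if u: "u \<ge> 0" for u
  proof -
    have seg: "closed_segment 0 (complex_of_real u) = of_real ` {0..u}"
      using closed_segment_of_real[of 0 u] u by (simp add: closed_segment_eq_real_ivl)
    have "norm (binomial_remainder (Suc p) a (of_real u) - binomial_remainder (Suc p) a 0)
        \<le> (norm a * C * u ^ p) * norm (complex_of_real u - 0)"
    proof (rule field_differentiable_bound[where S = "closed_segment 0 (complex_of_real u)"])
      fix z assume "z \<in> closed_segment 0 (complex_of_real u)"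
      then obtain v where v: "z = of_real v" "0 \<le> v" "v \<le> u" by (auto simp: seg)
      have "1 + z \<notin> \<real>\<^sub>\<le>\<^sub>0" using v by (auto simp: complex_nonpos_Reals_iff)
      then show "(binomial_remainder (Suc p) a has_field_derivative
          - a * binomial_remainder p (a + 1) z) (at z within closed_segment 0 (complex_of_real u))"
        by (rule binomial_remainder_deriv)
      have "norm (binomial_remainder p (a + 1) z) \<le> C * v ^ p" using C(2)[of v] v by simp
      also have "\<dots> \<le> C * u ^ p" using v C(1) by (intro mult_left_mono power_mono) auto
      finally show "norm (- a * binomial_remainder p (a + 1) z) \<le> norm a * C * u ^ p"
        by (simp add: norm_mult mult_left_mono mult.assoc)
    qed auto
    moreover have "binomial_remainder (Suc p) a 0 = 0"
      by (simp add: binomial_remainder_def sum.lessThan_Suc_shift del: sum.lessThan_Suc)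
    ultimately show ?thesis using u by (simp add: mult_ac)
  qed
  then show ?case using C(1) by (intro exI[of _ "norm a * C"]) auto
qed

lemma mellin_exists_binomial_remainder:
  assumes s: "- real (Suc p) < Re s" "Re s < - real p" and a: "Re a \<ge> 0"
  shows "mellin_exists (\<lambda>u. binomial_remainder (Suc p) a (of_real u)) s"
proof -
  obtain C where C: "C \<ge> 0"
    "\<And>u. u \<ge> 0 \<Longrightarrow> norm (binomial_remainder (Suc p) a (of_real u)) \<le> C * u ^ Suc p"
    using norm_binomial_remainder_le[OF a] by blast
  obtain C' where C': "C' \<ge> 0"
    "\<And>u. u \<ge> 0 \<Longrightarrow> norm (binomial_remainder p a (of_real u)) \<le> C' * u ^ p"
    using norm_binomial_remainder_le[OF a] by blast
  \<comment> \<open>\<open>min (u ^ p) (u ^ Suc p) \<le> 2 * u ^ Suc p / (1 + u)\<close>, and the right-hand side is a Beta integrand\<close>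
  define D where "D = 2 * (C + C' + norm (- a gchoose p))"
  define g where "g = (\<lambda>u. of_real (D * u ^ Suc p) * (1 + complex_of_real u) powr (- 1))"
  have "has_mellin (\<lambda>u. (1 + complex_of_real u) powr (- 1)) (s + of_nat (Suc p))
      (Gamma (s + of_nat (Suc p)) * Gamma (1 - (s + of_nat (Suc p))) / Gamma 1)"
    using s by (intro has_mellin_Beta) auto
  from has_mellin_mult_power[OF this, of "of_real D"] have g: "mellin_exists g s"
    by (simp add: has_mellin_iff g_def mult_ac)
  show ?thesis
  proof (rule mellin_exists_bound[OF g continuous_on_binomial_remainder])
    fix u :: real assume u: "u > 0"
    define r where "r = norm (binomial_remainder (Suc p) a (of_real u))"
    \<comment> \<open>Splitting off the last subtracted term trades the order \<open>p + 1\<close>,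
      good near 0, for the order \<open>p\<close>, good at infinity.\<close>
    have "binomial_remainder (Suc p) a (of_real u) =
        binomial_remainder p a (of_real u) - (- a gchoose p) * of_real u ^ p"
      by (simp add: binomial_remainder_def)
    then have "r \<le> norm (binomial_remainder p a (of_real u)) + norm ((- a gchoose p) * of_real u ^ p)"
      unfolding r_def by (metis norm_triangle_ineq4)
    also have "\<dots> \<le> C' * u ^ p + norm (- a gchoose p) * u ^ p"
      using C'(2)[of u] u by (simp add: norm_mult norm_power)
    finally have r1: "r \<le> (C' + norm (- a gchoose p)) * u ^ p" by (simp add: algebra_simps)
    have r2: "r \<le> C * u ^ Suc p" unfolding r_def using C(2)[of u] u by simp
    have "r * (1 + u) \<le> D * u ^ Suc p"
    proof (cases "u \<le> 1")
      case True
      have "r * (1 + u) \<le> (C * u ^ Suc p) * 2"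
        using r2 True u C(1) by (intro mult_mono) (auto simp: r_def)
      also have "\<dots> \<le> D * u ^ Suc p"
        using u C'(1) by (auto simp: D_def algebra_simps)
      finally show ?thesis .
    next
      case False
      have "r * (1 + u) \<le> ((C' + norm (- a gchoose p)) * u ^ p) * (2 * u)"
        using r1 False u C'(1) by (intro mult_mono) (auto simp: r_def)
      also have "\<dots> \<le> D * u ^ Suc p"
        using u C(1) by (auto simp: D_def algebra_simps)
      finally show ?thesis .
    qed
    then have "r \<le> D * u ^ Suc p / (1 + u)" using u by (simp add: field_simps)
    moreover have "norm (g u) = D * u ^ Suc p / (1 + u)"
    proof -
      have "norm ((1 + complex_of_real u) powr (- 1)) = 1 / (1 + u)"
        using norm_of_real_powr[of "1 + u" "-1"] u by (simp add: powr_minus divide_inverse)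
      moreover have "norm (complex_of_real (D * u ^ Suc p)) = D * u ^ Suc p"
        unfolding norm_of_real using u C(1) C'(1) by (intro abs_of_nonneg) (simp add: D_def)
      ultimately show ?thesis by (simp only: g_def norm_mult) simp
    qed
    ultimately show "norm (binomial_remainder (Suc p) a (of_real u)) \<le> norm (g u)"
      by (simp add: r_def)
  qed
qed

lemma notin_nonpos_Ints_if_Re_between:
  assumes "- real (Suc p) < Re s" "Re s < - real p"
  shows "s \<notin> \<int>\<^sub>\<le>\<^sub>0"
proof
  assume "s \<in> \<int>\<^sub>\<le>\<^sub>0"
  then obtain n where "s = - of_nat n" by (elim nonpos_Ints_cases')
  then show False using assms by auto
qed

text \<open>Induction by partial integration, which moves \<open>(Suc p, a, s)\<close> to
  \<open>(p, a + 1, s + 1)\<close> and leaves \<open>a - s\<close> fixed. The bound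
  \<open>Re s < 1 - p\<close> is conditional because it comes from the top subtracted power
  \<open>u ^ (p - 1)\<close> at infinity; for \<open>p = 0\<close> the decay of
  \<open>(1 + u) powr (- a)\<close> alone decides there.\<close>

lemma has_mellin_binomial_remainder:
  assumes "- real p < Re s" "p > 0 \<Longrightarrow> Re s < 1 - real p" "Re s < Re a" "0 < Re a"
  shows "has_mellin (\<lambda>u. binomial_remainder p a (of_real u)) s (Gamma s * Gamma (a - s) / Gamma a)"
  using assms
proof (induction p arbitrary: s a)
  case 0
  then show ?case using has_mellin_Beta[of s a] by (simp add: binomial_remainder_def)
next
  case (Suc p)
  define R where "R = (\<lambda>u. binomial_remainder (Suc p) a (complex_of_real u))"
  define Q where "Q = (\<lambda>u. binomial_remainder p (a + 1) (complex_of_real u))"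
  define V where "V = Gamma s * Gamma (a - s) / Gamma a"
  have sp: "- real (Suc p) < Re s" "Re s < - real p" and a: "Re a > 0"
    using Suc.prems by auto
  have s: "s \<notin> \<int>\<^sub>\<le>\<^sub>0" using sp by (rule notin_nonpos_Ints_if_Re_between)
  then have s0: "s \<noteq> 0" by auto
  have a0: "a \<notin> \<int>\<^sub>\<le>\<^sub>0" using a by (auto elim!: nonpos_Ints_cases)
  have R: "has_mellin R s (mellin R s)"
    using mellin_exists_binomial_remainder[OF sp, of a] a by (simp add: has_mellin_iff R_def)
  have "has_mellin Q (s + of_nat 1) (Gamma (s + 1) * Gamma (a + 1 - (s + 1)) / Gamma (a + 1))"
    using Suc.IH[of "s + 1" "a + 1"] Suc.prems by (auto simp: Q_def)
  then have Q: "has_mellin (\<lambda>u. - a / s * of_real u ^ 1 * Q u) s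
       (- a / s * (Gamma (s + 1) * Gamma (a + 1 - (s + 1)) / Gamma (a + 1)))"
    by (rule has_mellin_mult_power)
  moreover have "- a / s * (Gamma (s + 1) * Gamma (a + 1 - (s + 1)) / Gamma (a + 1)) = - V"
    unfolding Gamma_plus1[OF s] Gamma_plus1[OF a0] V_def
    using a0 s0 by (auto simp: Gamma_eq_zero_iff)
  ultimately have Q: "has_mellin (\<lambda>u. - a / s * of_real u ^ 1 * Q u) s (- V)" by simp
  \<comment> \<open>Partial integration: \<open>F\<close> has the derivative \<open>f\<close> and vanishes at \<open>0\<close> and at infinity\<close>
  define F where "F = (\<lambda>u. complex_of_real u powr s * R u / s)"
  define f where "f = (\<lambda>u. mellin_integrand R s u + mellin_integrand (\<lambda>u. - a / s * of_real u ^ 1 * Q u) s u)"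
  have f: "has_bochner_integral lborel (\<lambda>u. indicator {0<..} u *\<^sub>R f u) (mellin R s + - V)"
    using has_bochner_integral_add[OF R[unfolded has_mellin_def] Q[unfolded has_mellin_def]]
    by (simp add: f_def scaleR_add_right)
  have cont: "continuous_on {0<..} f"
    unfolding f_def mellin_integrand_def R_def Q_def
    by (intro continuous_intros continuous_on_binomial_remainder) (auto simp: complex_nonpos_Reals_iff)
  have deriv: "(F has_vector_derivative f u) (at u)" if u: "u > 0" for u
  proof -
    have nn: "complex_of_real u \<notin> \<real>\<^sub>\<le>\<^sub>0" "1 + complex_of_real u \<notin> \<real>\<^sub>\<le>\<^sub>0"
      using u by (auto simp: complex_nonpos_Reals_iff)
    have "((\<lambda>z. z powr s * binomial_remainder (Suc p) a z / s) has_field_derivative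
       (s * of_real u powr (s - 1) * R u + - a * Q u * of_real u powr s) / s) (at (of_real u))"
      unfolding R_def Q_def
      by (intro DERIV_cdivide DERIV_mult has_field_derivative_powr binomial_remainder_deriv nn)
    moreover have "(s * of_real u powr (s - 1) * R u + - a * Q u * of_real u powr s) / s = f u"
      using u s0 by (simp add: f_def mellin_integrand_def powr_diff field_simps)
    ultimately have "((\<lambda>z. z powr s * binomial_remainder (Suc p) a z / s) has_field_derivative f u) (at (of_real u))"
      by (simp only:)
    from has_vector_derivative_real_field[OF this] show ?thesis
      unfolding F_def R_def .
  qed
  \<comment> \<open>Near 0 the remainder is O(\<open>u ^ Suc p\<close>), and
    \<open>Re s + Suc p > 0\<close>. The form with \<open>real_of_ereal\<close> is the one that the
    fundamental theorem on an infinite interval takes.\<close>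
  have "((F \<circ> real_of_ereal) \<longlongrightarrow> 0) (at_right 0)"
  proof -
    obtain C where C: "\<And>u. u \<ge> 0 \<Longrightarrow> norm (R u) \<le> C * u ^ Suc p"
      using norm_binomial_remainder_le[of a "Suc p"] a unfolding R_def by auto
    have "((\<lambda>u. C / norm s * u powr (Re s + real (Suc p))) \<longlongrightarrow> C / norm s * 0) (at_right 0)"
      using sp by (intro tendsto_mult tendsto_const tendsto_zero_powrI[where b = "Re s + real (Suc p)"]
        tendsto_ident_at eventually_at_rightI[of 0 1]) auto
    moreover have "eventually (\<lambda>u. norm (F u) \<le> C / norm s * u powr (Re s + real (Suc p))) (at_right 0)"
      using eventually_at_right_less[of 0]
    proof eventually_elim
      case (elim u)
      have "norm (F u) = u powr Re s * norm (R u) / norm s"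
        using elim by (simp add: F_def norm_mult norm_divide norm_of_real_powr)
      also have "\<dots> \<le> u powr Re s * (C * u powr real (Suc p)) / norm s"
        using C[of u] elim powr_realpow[OF elim, of "Suc p"]
        by (intro divide_right_mono mult_left_mono) auto
      finally show ?case by (simp add: powr_add mult_ac)
    qed
    ultimately have "(F \<longlongrightarrow> 0) (at_right 0)"
      by (intro Lim_null_comparison[of F "\<lambda>u. C / norm s * u powr (Re s + real (Suc p))"]) simp_all
    then show ?thesis unfolding zero_ereal_def ereal_tendsto_simps1 .
  qed
  \<comment> \<open>At infinity the remainder with one term fewer and the split-off term are both
    O(\<open>u ^ p\<close>), and \<open>Re s + p < 0\<close>.\<close>
  moreover have "((F \<circ> real_of_ereal) \<longlongrightarrow> 0) (at_left \<infinity>)"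
  proof -
    obtain C where C: "\<And>u. u \<ge> 0 \<Longrightarrow> norm (binomial_remainder p a (of_real u)) \<le> C * u ^ p"
      using norm_binomial_remainder_le[of a p] a by auto
    define D where "D = C + norm (- a gchoose p)"
    have "((\<lambda>u. D / norm s * u powr (Re s + real p)) \<longlongrightarrow> D / norm s * 0) at_top"
      using sp by (intro tendsto_mult tendsto_const tendsto_neg_powr filterlim_ident) auto
    moreover have "eventually (\<lambda>u. norm (F u) \<le> D / norm s * u powr (Re s + real p)) at_top"
      using eventually_gt_at_top[of 0]
    proof eventually_elim
      case (elim u)
      have "R u = binomial_remainder p a (of_real u) - (- a gchoose p) * of_real u ^ p"
        by (simp add: binomial_remainder_def R_def)
      then have "norm (R u) \<le> norm (binomial_remainder p a (of_real u)) + norm ((- a gchoose p) * of_real u ^ p)"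
        by (metis norm_triangle_ineq4)
      then have R: "norm (R u) \<le> D * u powr real p"
        using C[of u] elim by (simp add: norm_mult norm_power D_def algebra_simps powr_realpow)
      have "norm (F u) = u powr Re s * norm (R u) / norm s"
        using elim by (simp add: F_def norm_mult norm_divide norm_of_real_powr)
      also have "\<dots> \<le> u powr Re s * (D * u powr real p) / norm s"
        using R by (intro divide_right_mono mult_left_mono) auto
      finally show ?case by (simp add: powr_add mult_ac)
    qed
    ultimately have "(F \<longlongrightarrow> 0) at_top"
      by (intro Lim_null_comparison[of F "\<lambda>u. D / norm s * u powr (Re s + real p)"]) simp_all
    then show ?thesis unfolding ereal_tendsto_simps1 .
  qed
  ultimately have "(LBINT u=0..\<infinity>. f u) = 0 - 0"
  proof (intro interval_integral_FTC_integrable[where F = F])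
    show "set_integrable lborel (einterval 0 \<infinity>) f"
      using f unfolding zero_ereal_def einterval_eq set_integrable_def by (simp add: has_bochner_integral_iff)
    show "isCont f u" if "0 < ereal u" for u
      using cont that by (auto simp: continuous_on_eq_continuous_at)
    show "(F has_vector_derivative f u) (at u)" if "0 < ereal u" for u
      using that by (intro deriv) simp
  qed simp_all
  moreover have "(LBINT u=0..\<infinity>. f u) = mellin R s + - V"
    unfolding interval_lebesgue_integral_0_infty set_lebesgue_integral_def
    using f by (simp add: has_bochner_integral_iff)
  ultimately have "mellin R s = V" by simp
  with R show ?case by (simp add: R_def V_def)
qed

subsection \<open>Euler's transformation\<close>

lemma fps_hypergeo_21_rec:
  fixes a b c :: "'a::field_char_0"
  assumes "c \<notin> \<int>\<^sub>\<le>\<^sub>0"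
  shows "(of_nat n + 1) * (of_nat n + c) * fps_hypergeo [a, b] [c] 1 $ Suc n =
           (of_nat n + a) * (of_nat n + b) * fps_hypergeo [a, b] [c] 1 $ n"
proof -
  have "pochhammer c (Suc n) \<noteq> 0"
    using assms pochhammer_eq_0_imp_nonpos_Int by blast
  then have "pochhammer c n \<noteq> 0" "c + of_nat n \<noteq> 0"
    by (auto simp: pochhammer_Suc)
  moreover have "(1 + of_nat n :: 'a) \<noteq> 0"
    by (metis of_nat_Suc of_nat_eq_0_iff nat.distinct(1))
  moreover from this have "fact n + fact n * of_nat n \<noteq> (0 :: 'a)"
    by (metis fact_nonzero distrib_left mult.right_neutral mult_eq_0_iff)
  ultimately show ?thesis
    by (simp add: pochhammer_Suc divide_simps) (simp add: algebra_simps)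
qed

text \<open>The left-hand side of Gauss's hypergeometric differential equation, as an operator on
  formal power series: uniqueness of solutions becomes a recursion for coefficients, without any
  analysis.\<close>

definition hypergeo_ode :: "complex \<Rightarrow> complex \<Rightarrow> complex \<Rightarrow> complex fps \<Rightarrow> complex fps" where
  "hypergeo_ode a b c Y =
     fps_X * (1 - fps_X) * fps_deriv (fps_deriv Y) +
     (fps_const c - (fps_const a + fps_const b + 1) * fps_X) * fps_deriv Y -
     fps_const a * fps_const b * Y"

lemma hypergeo_ode_nth:
  "hypergeo_ode a b c Y $ n =
     (of_nat n + 1) * (of_nat n + c) * Y $ Suc n - (of_nat n + a) * (of_nat n + b) * Y $ n"
proof -
  have "hypergeo_ode a b c Y =
     fps_X * fps_deriv (fps_deriv Y) - fps_X * (fps_X * fps_deriv (fps_deriv Y)) +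
     fps_const c * fps_deriv Y - fps_const (a + b + 1) * (fps_X * fps_deriv Y) -
     fps_const (a * b) * Y"
    unfolding hypergeo_ode_def fps_const_add[symmetric] fps_const_mult[symmetric] fps_const_1_eq_1
    by (simp only: algebra_simps mult_1_left)
  note e = this
  show ?thesis unfolding e
    \<comment> \<open>The double product with \<open>fps_X\<close> shifts by two places, so
      \<open>n = 0\<close>, \<open>n = 1\<close> and larger \<open>n\<close> are separate
      cases.\<close>
    by (cases n; cases "n - 1") (auto simp: algebra_simps)
qed

text \<open>The condition on \<open>c\<close> keeps the leading factor
  \<open>(n + 1) * (n + c)\<close> of the recursion nonzero, so the constant coefficient determines
  all others.\<close>

lemma hypergeo_ode_unique:
  fixes Y :: "complex fps"
  assumes "c \<notin> \<int>\<^sub>\<le>\<^sub>0" and "hypergeo_ode a b c Y = 0" and "Y $ 0 = 1"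
  shows "Y = fps_hypergeo [a, b] [c] 1"
proof (rule fps_ext)
  fix n
  show "Y $ n = fps_hypergeo [a, b] [c] 1 $ n"
  proof (induction n)
    case (Suc n)
    have "c + of_nat n \<noteq> 0"
      using assms(1) by (metis add_eq_0_iff minus_of_nat_in_nonpos_Ints add.commute)
    then have "(of_nat n + 1) * (of_nat n + c) \<noteq> 0"
      by (metis add.commute mult_eq_0_iff of_nat_Suc of_nat_eq_0_iff nat.distinct(1))
    moreover have "(of_nat n + 1) * (of_nat n + c) * Y $ Suc n =
        (of_nat n + 1) * (of_nat n + c) * fps_hypergeo [a, b] [c] 1 $ Suc n"
      using arg_cong[OF assms(2), of "\<lambda>f. f $ n"] fps_hypergeo_21_rec[OF assms(1), of n a b] Suc
      by (simp only: hypergeo_ode_nth fps_zero_nth) (simp only: right_minus_eq)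
    ultimately show ?case by (metis mult_left_cancel)
  qed (simp add: assms(3))
qed

definition fps_one_minus_power :: "complex \<Rightarrow> complex fps" where
  "fps_one_minus_power m = Abs_fps (\<lambda>n. (-1) ^ n * (m gchoose n))"

lemma fps_one_minus_power_deriv:
  "(1 - fps_X) * fps_deriv (fps_one_minus_power m) = - (fps_const m * fps_one_minus_power m)"
proof (rule fps_ext)
  fix n
  have "m * (m gchoose n) = of_nat n * (m gchoose n) + of_nat (Suc n) * (m gchoose Suc n)"
    by (rule gbinomial_mult_1)
  then have e: "of_nat (Suc n) * (m gchoose Suc n) = m * (m gchoose n) - of_nat n * (m gchoose n)"
    by simp
  have "((1 - fps_X) * fps_deriv (fps_one_minus_power m)) $ n =
     (-1) ^ Suc n * (of_nat (Suc n) * (m gchoose Suc n)) - of_nat n * ((-1) ^ n * (m gchoose n))"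
    by (cases n) (simp_all add: fps_one_minus_power_def left_diff_distrib)
  also have "\<dots> = (- (fps_const m * fps_one_minus_power m)) $ n"
    unfolding e by (simp add: fps_one_minus_power_def algebra_simps)
  finally show "((1 - fps_X) * fps_deriv (fps_one_minus_power m)) $ n = 
    (- (fps_const m * fps_one_minus_power m)) $ n" .
qed

text \<open>Both sides have constant coefficient 1, so by \<open>hypergeo_ode_unique\<close> it
  suffices that the product solves the equation for \<open>a\<close>, \<open>b\<close>,
  \<open>c\<close>. This follows algebraically from the first-order equation of the power and the
  equation for \<open>c - a\<close>, \<open>c - b\<close>, \<open>c\<close> of the other
  factor.\<close>

lemma fps_euler_transformation:
  assumes c: "c \<notin> \<int>\<^sub>\<le>\<^sub>0"
  shows "fps_hypergeo [a, b] [c] 1 =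
           fps_one_minus_power (c - a - b) * fps_hypergeo [c - a, c - b] [c] 1"
proof (rule hypergeo_ode_unique[OF c, symmetric])
  define m where "m = c - a - b"
  define G where "G = fps_one_minus_power m"
  define F where "F = fps_hypergeo [c - a, c - b] [c] (1 :: complex)"
  define D where "D = (fps_deriv :: complex fps \<Rightarrow> complex fps)"
  define X where "X = (fps_X :: complex fps)"
  define A B C M where "A = fps_const a" and "B = fps_const b" and "C = fps_const c"
    and "M = fps_const m"
  have M: "M = C - A - B" by (simp add: M_def m_def A_def B_def C_def)
  have "hypergeo_ode (c - a) (c - b) c F = 0"
    unfolding F_def fps_eq_iff hypergeo_ode_nth using fps_hypergeo_21_rec[OF c, of _ "c - a" "c - b"]
    by (simp del: fps_hypergeo_nth)
  then have F: "X * (1 - X) * D (D F) + (C - ((C - A) + (C - B) + 1) * X) * D F - (C - A) * (C - B) * F = 0"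
    by (simp add: hypergeo_ode_def D_def X_def A_def B_def C_def)
  have G1: "(1 - X) * D G = - (M * G)"
    using fps_one_minus_power_deriv by (simp add: X_def D_def M_def G_def)
  have G2: "(1 - X) * D (D G) - D G = - (M * D G)"
    using arg_cong[OF G1, of D] by (simp add: D_def X_def M_def algebra_simps)
  have D1: "D (G * F) = D G * F + G * D F"
    and D2: "D (D (G * F)) = D (D G) * F + 2 * D G * D F + G * D (D F)"
    by (simp_all add: D_def algebra_simps)
  \<comment> \<open>The extra factor \<open>1 - X\<close> lets every derivative of \<open>G\<close>
    be eliminated through \<open>(1 - X) * D G = - (M * G)\<close>. It is cancelled at the end, as
    formal power series have no zero divisors here.\<close>
  have "(1 - X) * (X * (1 - X) * D (D (G * F)) + (C - (A + B + 1) * X) * D (G * F) - A * B * (G * F)) = 0"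
  proof -
    define F1 F2 G1 G2 where "F1 = D F" and "F2 = D (D F)" and "G1 = D G" and "G2 = D (D G)"
    define R where "R = C - (A + B + 1) * X"
    define S where "S = C - ((C - A) + (C - B) + 1) * X"
    have f2: "X * (1 - X) * F2 = (C - A) * (C - B) * F - S * F1"
      using F unfolding F1_def F2_def S_def by (simp add: algebra_simps)
    have g1: "(1 - X) * G1 = - (M * G)" using G1 by (simp add: G1_def)
    have g2: "(1 - X) * G2 = G1 - M * G1" using G2 by (simp add: G1_def G2_def algebra_simps)
    have "(1 - X) * (X * (1 - X) * (G2 * F + 2 * G1 * F1 + G * F2) + R * (G1 * F + G * F1) - A * B * (G * F)) =
      X * F * (1 - X) * ((1 - X) * G2) + 2 * X * (1 - X) * F1 * ((1 - X) * G1) +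
      (1 - X) * G * (X * (1 - X) * F2) + R * F * ((1 - X) * G1) + R * (1 - X) * G * F1 - A * B * (1 - X) * G * F"
      by (simp add: algebra_simps)
    also have "\<dots> = X * F * (1 - M) * ((1 - X) * G1) + 2 * X * (1 - X) * F1 * ((1 - X) * G1) +
      (1 - X) * G * (X * (1 - X) * F2) + R * F * ((1 - X) * G1) + R * (1 - X) * G * F1 - A * B * (1 - X) * G * F"
      unfolding g2 by (simp add: algebra_simps)
    \<comment> \<open>Only multiples of \<open>G * F\<close> and \<open>G * F1\<close> are left;
      both coefficients vanish once \<open>M = C - A - B\<close> is inserted.\<close>
    also have "\<dots> = G * F * (- (X * (1 - M) * M) + (1 - X) * ((C - A) * (C - B) - A * B) - R * M)
       + G * F1 * (1 - X) * (R - S - 2 * X * M)"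
      unfolding g1 f2 by (simp add: algebra_simps)
    also have "R - S - 2 * X * M = 0"
      unfolding R_def S_def M by (simp add: algebra_simps)
    also have "- (X * (1 - M) * M) + (1 - X) * ((C - A) * (C - B) - A * B) - R * M = 0"
      unfolding R_def M by (simp add: algebra_simps)
    finally show ?thesis
      unfolding D2 unfolding D1 F1_def F2_def G1_def G2_def R_def by simp
  qed
  then show "hypergeo_ode a b c (fps_one_minus_power (c - a - b) *
      fps_hypergeo [c - a, c - b] [c] 1) = 0"
  proof -
    assume *: "(1 - X) * (X * (1 - X) * D (D (G * F)) + (C - (A + B + 1) * X) * D (G * F) - A * B * (G * F)) = 0"
    have "fps_nth (1 - X) 0 \<noteq> 0" by (simp add: X_def)
    then have "1 - X \<noteq> 0" by (metis fps_zero_nth)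
    with * show ?thesis
      by (simp add: hypergeo_ode_def D_def X_def A_def B_def C_def F_def G_def m_def)
  qed
qed (simp add: fps_one_minus_power_def)

lemma summable_hypergeo:
  fixes a b c z :: complex
  assumes c: "c \<notin> \<int>\<^sub>\<le>\<^sub>0" and z: "norm z < 1"
  shows "summable (\<lambda>n. fps_hypergeo [a, b] [c] 1 $ n * z ^ n)"
proof -
  define y where "y = (\<lambda>n. fps_hypergeo [a, b] [c] 1 $ n)"
  \<comment> \<open>The quotient of consecutive terms, divided through by \<open>n ^ 2\<close> to
    show the limit \<open>norm z\<close>. At \<open>n = 0\<close> the divisions by
    \<open>of_nat n\<close> take the default value 0, so the estimate below starts at
    \<open>max N 1\<close>.\<close>
  define r where "r = (\<lambda>n. norm ((a / of_nat n + 1) * (b / of_nat n + 1) /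
    ((1 / of_nat n + 1) * (c / of_nat n + 1)) * z))"
  have "r \<longlonglongrightarrow> norm ((0 + 1) * (0 + 1) / ((0 + 1) * (0 + 1)) * z)"
    unfolding r_def by (intro tendsto_intros lim_const_over_n) auto
  then have "r \<longlonglongrightarrow> norm z" by simp
  moreover obtain K where K: "norm z < K" "K < 1" using dense[OF z] by blast
  ultimately have "eventually (\<lambda>n. r n < K) sequentially"
    by (auto dest: order_tendstoD)
  then obtain N where N: "\<And>n. n \<ge> N \<Longrightarrow> r n < K"
    by (auto simp: eventually_sequentially)
  have "norm (y (Suc n) * z ^ Suc n) \<le> K * norm (y n * z ^ n)" if n: "n \<ge> max N 1" for n
  proof -
    have n0: "of_nat n \<noteq> (0::complex)" using n by auto
    have c0: "of_nat n + c \<noteq> 0"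
      using c by (metis add_eq_0_iff minus_of_nat_in_nonpos_Ints)
    have n1: "of_nat n + 1 \<noteq> (0::complex)"
      by (metis add.commute of_nat_Suc of_nat_eq_0_iff nat.distinct(1))
    have "y (Suc n) = (of_nat n + a) * (of_nat n + b) / ((of_nat n + 1) * (of_nat n + c)) * y n"
      using fps_hypergeo_21_rec[OF c, of n a b] n1 c0 unfolding y_def
      by (simp add: nonzero_eq_divide_eq mult.commute del: fps_hypergeo_nth)
    also have "(of_nat n + a) * (of_nat n + b) / ((of_nat n + 1) * (of_nat n + c)) =
       (of_nat n * (a / of_nat n + 1)) * (of_nat n * (b / of_nat n + 1)) /
    ((of_nat n * (1 / of_nat n + 1)) * (of_nat n * (c / of_nat n + 1)))"
      using n0 by (simp add: distrib_left add.commute)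
    also have "\<dots> = (a / of_nat n + 1) * (b / of_nat n + 1) /
    ((1 / of_nat n + 1) * (c / of_nat n + 1))"
      using n0 by simp
    finally have "norm (y (Suc n) * z ^ Suc n) = r n * norm (y n * z ^ n)"
      unfolding r_def by (simp add: norm_mult norm_divide norm_power)
    also have "\<dots> \<le> K * norm (y n * z ^ n)"
      using N[of n] n by (intro mult_right_mono) auto
    finally show ?thesis .
  qed
  then show ?thesis
    unfolding y_def[symmetric] using K by (intro summable_ratio_test[of K "max N 1"])
qed

lemma fps_conv_radius_hypergeo:
  fixes a b c :: complex
  assumes "c \<notin> \<int>\<^sub>\<le>\<^sub>0"
  shows "fps_conv_radius (fps_hypergeo [a, b] [c] 1) \<ge> 1"
  unfolding fps_conv_radius_def
  by (rule conv_radius_geI_ex') (use summable_hypergeo[OF assms] in \<open>simp del: fps_hypergeo_nth\<close>)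

text \<open>The formal identity carries over because evaluation is multiplicative where both factors
  converge, here with radius at least 1, and the binomial series sums to the principal
  branch.\<close>

lemma euler_transformation:
  assumes c: "c \<notin> \<int>\<^sub>\<le>\<^sub>0" and z: "norm z < 1"
  shows "hyp2F1 a b c z = (1 - z) powr (c - a - b) * hyp2F1 (c - a) (c - b) c z"
proof -
  define m where "m = c - a - b"
  have s: "(\<lambda>n. fps_one_minus_power m $ n * w ^ n) sums (1 - w) powr m" if "norm w < 1" for w
    using gen_binomial_complex[of "- w" m] that
    by (simp add: fps_one_minus_power_def power_minus[of w] mult_ac)
  have "fps_conv_radius (fps_one_minus_power m) \<ge> 1"
    unfolding fps_conv_radius_def
    by (rule conv_radius_geI_ex') (use s in \<open>auto simp: sums_iff\<close>)
  moreover have "ereal (norm z) < 1" using z by simp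
  ultimately have "hyp2F1 a b c z = eval_fps (fps_one_minus_power m) z * hyp2F1 (c - a) (c - b) c z"
    using fps_conv_radius_hypergeo[OF c, of "c - a" "c - b"]
    unfolding hyp2F1_def m_def fps_euler_transformation[OF c, of a b]
    by (intro eval_fps_mult) (auto intro: less_le_trans[of _ "1::ereal"])
  also have "eval_fps (fps_one_minus_power m) z = (1 - z) powr m"
    using s[OF z] by (simp add: eval_fps_def sums_iff)
  finally show ?thesis by (simp add: m_def)
qed

subsection \<open>Termwise Mellin transform of the generating function\<close>

text \<open>A summable \<open>w\<close> times the single integrable \<open>g\<close> controls the
  sum of the integrals of norms, which permits termwise integration. The bound is asked only from
  \<open>N\<close> on: in the application the terms before that carry subtracted polynomials, and
  finitely many of them do not affect summability.\<close>

lemma has_mellin_suminf: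
  assumes f: "\<And>n. has_mellin (f n) s (v n)"
    and h: "\<And>u. u > 0 \<Longrightarrow> (\<lambda>n. f n u) sums h u"
    and g: "mellin_exists g s" and w: "summable w"
    and bound: "\<And>n u. n \<ge> N \<Longrightarrow> u > 0 \<Longrightarrow> norm (f n u) \<le> w n * norm (g u)"
  shows "has_mellin h s (\<Sum>n. v n)"
proof -
  define F where "F = (\<lambda>n u. indicator {0<..} u *\<^sub>R mellin_integrand (f n) s u)"
  define G where "G = (\<lambda>u. indicator {0<..} u *\<^sub>R mellin_integrand g s u)"
  define H where "H = (\<lambda>u. indicator {0<..} u *\<^sub>R mellin_integrand h s u)"
  have F: "has_bochner_integral lborel (F n) (v n)" for n
    using f[of n] by (simp add: has_mellin_def F_def)
  then have Fi: "integrable lborel (F n)" for n by (simp add: has_bochner_integral_iff)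
  have G: "integrable lborel G" using g by (simp add: G_def mellin_existsD)
  have le: "norm (F n u) \<le> w n * norm (G u)" if "n \<ge> N" for n u
    using mult_right_mono[OF bound[OF that], of u "norm (complex_of_real u powr (s - 1))"]
    by (cases "u > 0") (auto simp: F_def G_def mellin_integrand_def norm_mult mult.assoc)
  have sums: "(\<lambda>n. F n u) sums H u" for u
  proof (cases "u > 0")
    case True
    show ?thesis
      using sums_mult2[OF h[OF True], of "complex_of_real u powr (s - 1)"] True
      by (simp add: F_def H_def mellin_integrand_def)
  qed (simp add: F_def H_def)
  have summ: "summable (\<lambda>n. norm (F n u))" for u
    by (rule summable_comparison_test'[OF summable_mult2[OF w, of "norm (G u)"], of N])
      (simp add: le)
  have "summable (\<lambda>n. \<integral>u. norm (F n u) \<partial>lborel)"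
  proof (rule summable_comparison_test'[OF summable_mult2[OF w, of "\<integral>u. norm (G u) \<partial>lborel"], of N])
    fix n assume n: "n \<ge> N"
    have "(\<integral>u. norm (F n u) \<partial>lborel) \<le> (\<integral>u. w n * norm (G u) \<partial>lborel)"
      using Fi G n by (intro integral_mono le integrable_norm integrable_mult_right) auto
    then show "norm (\<integral>u. norm (F n u) \<partial>lborel) \<le> w n * (\<integral>u. norm (G u) \<partial>lborel)"
      by simp
  qed
  note * = Fi AE_I2[of lborel, OF summ] this
  have H: "H = (\<lambda>u. \<Sum>n. F n u)" using sums by (auto simp: sums_iff)
  have "integrable lborel H" unfolding H by (rule integrable_suminf[OF *])
  moreover have "integral\<^sup>L lborel H = (\<Sum>n. v n)"
    unfolding H integral_suminf[OF *] using F by (simp add: has_bochner_integral_iff)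
  ultimately show ?thesis by (simp add: has_mellin_def H_def has_bochner_integral_iff)
qed

section \<open>Taylor polynomials determined by bounds to the right of 0\<close>

text \<open>Letting \<open>u\<close> tend to 0 from the right kills the constant term; dividing by
  \<open>u\<close> then lowers \<open>N\<close> for the induction. The lemma serves to identify two
  polynomials that approximate one function up to O(\<open>u ^ N\<close>).\<close>

lemma poly_coeffs_zero_if_small:
  fixes d :: "nat \<Rightarrow> complex"
  assumes "\<And>u::real. 0 < u \<Longrightarrow> u \<le> r \<Longrightarrow> norm (\<Sum>k<N. d k * of_real u ^ k) \<le> K * u ^ N"
    and r: "r > 0" and "k < N"
  shows "d k = 0"
  using assms(1,3)
proof (induction N arbitrary: d k)
  case (Suc N)
  have peel: "(\<Sum>k<Suc N. d k * of_real u ^ k) = d 0 + of_real u * (\<Sum>k<N. d (Suc k) * of_real u ^ k)" for u :: real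
    by (subst sum.lessThan_Suc_shift) (simp add: sum_distrib_left mult_ac)
  have ev: "eventually (\<lambda>u. 0 < u \<and> u \<le> r) (at_right (0::real))"
    using r by (auto simp: eventually_at_right_field intro: exI[of _ r])
  have d0: "d 0 = 0"
  proof -
    define p where "p = (\<lambda>u::real. d 0 + of_real u * (\<Sum>k<N. d (Suc k) * of_real u ^ k))"
    have "isCont p 0" unfolding p_def by (intro continuous_intros)
    then have "(p \<longlongrightarrow> d 0) (at_right 0)"
      unfolding isCont_def by (rule filterlim_mono) (auto simp: p_def at_le)
    moreover have "(p \<longlongrightarrow> 0) (at_right 0)"
    proof (rule Lim_null_comparison)
      show "eventually (\<lambda>u. norm (p u) \<le> K * u ^ Suc N) (at_right 0)"
        using ev by eventually_elim (use Suc.prems(1) in \<open>simp add: p_def peel del: sum.lessThan_Suc\<close>)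
      have "isCont (\<lambda>u. K * u ^ Suc N) 0" by (intro continuous_intros)
      then show "((\<lambda>u. K * u ^ Suc N) \<longlongrightarrow> 0) (at_right 0)"
        unfolding isCont_def by (rule filterlim_mono) (auto simp: at_le)
    qed
    ultimately show ?thesis by (intro tendsto_unique[of "at_right 0" p]) auto
  qed
  have "norm (\<Sum>k<N. d (Suc k) * of_real u ^ k) \<le> K * u ^ N" if u: "0 < u" "u \<le> r" for u :: real
  proof -
    have "u * norm (\<Sum>k<N. d (Suc k) * of_real u ^ k) \<le> u * (K * u ^ N)"
      using Suc.prems(1)[OF u] u unfolding peel d0 by (simp add: norm_mult mult_ac)
    then show ?thesis using u by simp
  qed
  then have "d (Suc j) = 0" if "j < N" for j
    using Suc.IH[of "\<lambda>k. d (Suc k)" j] that by blast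
  with d0 Suc.prems(2) show ?case by (cases k) auto
qed simp

lemma norm_powser_tail_le:
  fixes a :: "nat \<Rightarrow> complex" and F :: "real \<Rightarrow> complex"
  assumes "\<And>t::real. 0 < t \<Longrightarrow> t < 1 \<Longrightarrow> (\<lambda>k. a k * of_real t ^ k) sums F t"
  shows "\<exists>K. \<forall>t. 0 < t \<longrightarrow> t \<le> 1 / 2 \<longrightarrow> norm (F t - (\<Sum>k<N. a k * of_real t ^ k)) \<le> K * t ^ N"
proof -
  \<comment> \<open>Any point strictly between \<open>1 / 2\<close> and 1 would do in place of
    \<open>3 / 4\<close>: convergence there gives absolute convergence at \<open>1 / 2\<close>,
    which bounds the tail for all \<open>t \<le> 1 / 2\<close>.\<close>
  have "summable (\<lambda>k. a k * of_real (3/4) ^ k)"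
    using assms[of "3/4"] by (auto simp: sums_iff)
  from powser_insidea[OF this, of "1 / 2"]
  have "summable (\<lambda>k. norm (a k * (1 / 2) ^ k))" by simp
  then have "summable (\<lambda>k. norm (a (k + N) * (1 / 2) ^ (k + N)))" by (rule summable_ignore_initial_segment)
  moreover have e: "2 ^ N * norm (a (k + N) * (1 / 2) ^ (k + N)) = norm (a (k + N)) * (1 / 2) ^ k" for k
    by (simp add: norm_mult norm_divide norm_power power_add power_one_over)
  ultimately have summ: "summable (\<lambda>k. norm (a (k + N)) * (1 / 2) ^ k)"
    using summable_mult[of _ "2 ^ N"] by (simp only: flip: e)
  have "norm (F t - (\<Sum>k<N. a k * of_real t ^ k)) \<le> (\<Sum>k. norm (a (k + N)) * (1 / 2) ^ k) * t ^ N"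
    if t: "0 < t" "t \<le> 1 / 2" for t
  proof -
    have s: "(\<lambda>k. a (k + N) * of_real t ^ (k + N)) sums (F t - (\<Sum>k<N. a k * of_real t ^ k))"
      using assms[of t] t by (intro sums_split_initial_segment) auto
    have "norm (\<Sum>k. a (k + N) * of_real t ^ (k + N)) \<le> (\<Sum>k. norm (a (k + N)) * (1 / 2) ^ k * t ^ N)"
    proof (rule norm_suminf_le)
      fix k
      have "t ^ k \<le> (1 / 2) ^ k" using t by (intro power_mono) auto
      then have "norm (a (k + N)) * t ^ k * t ^ N \<le> norm (a (k + N)) * (1 / 2) ^ k * t ^ N"
        using t by (intro mult_right_mono mult_left_mono) auto
      then show "norm (a (k + N) * of_real t ^ (k + N)) \<le> norm (a (k + N)) * (1 / 2) ^ k * t ^ N"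
        using t by (simp add: norm_mult norm_power power_add mult.assoc del: mult_le_cancel_left)
    qed (use summ in \<open>rule summable_mult2\<close>)
    also have "\<dots> = (\<Sum>k. norm (a (k + N)) * (1 / 2) ^ k) * t ^ N"
      by (rule suminf_mult2[OF summ, symmetric])
    finally show ?thesis using s by (simp add: sums_iff)
  qed
  then show ?thesis by blast
qed

section \<open>Expansion of the generating function and its coefficients\<close>

lemma gegenbauer_generating_expansion:
  fixes \<xi> u :: real and l :: complex
  assumes xi: "-1 < \<xi>" "\<xi> < 1" and u: "u > 0"
  defines "z \<equiv> (1 - \<xi>) / 2"
  shows "(\<lambda>n. pochhammer l n / fact n * of_real (4 * z) ^ n * of_real u ^ n *
            (1 + of_real u) powr (- (2 * l + 2 * of_nat n)))
         sums (complex_of_real (1 + 2 * u * \<xi> + u\<^sup>2) powr (- l))"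
proof -
  define w where "w = 4 * z * u / (1 + u)\<^sup>2"
  \<comment> \<open>This is \<open>(1 - u) ^ 2 \<ge> 0\<close>; with \<open>z < 1\<close> it keeps
    \<open>w\<close> strictly below 1, inside the disc of the binomial series.\<close>
  have "4 * u \<le> (1 + u)\<^sup>2" using sum_squares_ge_zero[of "1 - u" 0] by (simp add: power2_eq_square algebra_simps)
  moreover have "4 * z * u < 4 * u" using xi u by (simp add: z_def)
  ultimately have w: "0 \<le> w" "w < 1"
    using xi u by (auto simp: w_def z_def field_simps)
  have e: "(1 - w) * (1 + u)\<^sup>2 = 1 + 2 * u * \<xi> + u\<^sup>2"
  proof -
    have "w * (1 + u)\<^sup>2 = 4 * z * u" using u by (simp add: w_def)
    then show ?thesis by (simp add: left_diff_distrib z_def) (simp add: power2_eq_square algebra_simps)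
  qed
  have "(\<lambda>n. (- l gchoose n) * (- of_real w) ^ n) sums (1 + - complex_of_real w) powr (- l)"
    using w by (intro gen_binomial_complex) auto
  then have "(\<lambda>n. (- l gchoose n) * (- of_real w) ^ n * of_real ((1 + u)\<^sup>2) powr (- l)) sums
      ((1 + - complex_of_real w) powr (- l) * of_real ((1 + u)\<^sup>2) powr (- l))"
    by (rule sums_mult2)
  also have "(1 + - complex_of_real w) powr (- l) * of_real ((1 + u)\<^sup>2) powr (- l) =
      complex_of_real ((1 - w) * (1 + u)\<^sup>2) powr (- l)"
    using w u powr_times_real[of "of_real (1 - w)" "of_real ((1 + u)\<^sup>2)" "- l"] by simp
  also have "(\<lambda>n. (- l gchoose n) * (- of_real w) ^ n * of_real ((1 + u)\<^sup>2) powr (- l)) =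
     (\<lambda>n. pochhammer l n / fact n * of_real (4 * z) ^ n * of_real u ^ n *
            (1 + of_real u) powr (- (2 * l + 2 * of_nat n)))"
  proof
    fix n
    have u1: "1 + complex_of_real u \<noteq> 0" using u by (auto dest: arg_cong[of _ _ Re])
    have "(- l gchoose n) * (- of_real w) ^ n = pochhammer l n / fact n * of_real w ^ n"
      by (simp add: gbinomial_pochhammer power_minus[of "of_real w"])
    also have "complex_of_real w ^ n = of_real (4 * z) ^ n * of_real u ^ n / (1 + of_real u) ^ (2 * n)"
      by (simp add: w_def power_divide power_mult_distrib power_mult)
    finally have 1: "(- l gchoose n) * (- of_real w) ^ n =
       pochhammer l n / fact n * (of_real (4 * z) ^ n * of_real u ^ n / (1 + of_real u) ^ (2 * n))" .
    have "complex_of_real ((1 + u)\<^sup>2) powr (- l) = (1 + of_real u) powr (- l) * (1 + of_real u) powr (- l)"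
      using u powr_times_real[of "of_real (1 + u)" "of_real (1 + u)" "- l"] by (simp add: power2_eq_square)
    also have "\<dots> = (1 + of_real u) powr (- (2 * l))"
      by (simp flip: powr_add)
    finally have 2: "complex_of_real ((1 + u)\<^sup>2) powr (- l) = (1 + of_real u) powr (- (2 * l))" .
    have "(1 + complex_of_real u) powr (- (2 * l + 2 * of_nat n)) =
        (1 + of_real u) powr (- (2 * l)) / (1 + of_real u) powr (of_nat (2 * n))"
      by (simp add: algebra_simps flip: powr_diff)
    also have "(1 + complex_of_real u) powr (of_nat (2 * n)) = (1 + of_real u) ^ (2 * n)"
      by (rule powr_complexpow[OF u1])
    finally show "(- l gchoose n) * (- of_real w) ^ n * of_real ((1 + u)\<^sup>2) powr (- l) =
       pochhammer l n / fact n * of_real (4 * z) ^ n * of_real u ^ n *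
            (1 + of_real u) powr (- (2 * l + 2 * of_nat n))"
      unfolding 1 2 by simp
  qed
  finally show ?thesis unfolding e .
qed

text \<open>By \<open>pochhammer (2 * l) (2 * n) = 4 ^ n * pochhammer l n * pochhammer (l + 1 / 2)
  n\<close> the factors \<open>4 ^ n\<close> and \<open>pochhammer l n\<close> cancel, which leaves
  \<open>l + 1 / 2\<close> as the lower parameter. The Gamma factors in the numerator shift by
  \<open>n\<close> and yield the upper parameters.\<close>

lemma mellin_term_coeff:
  fixes l s :: complex
  assumes l: "Re l > 0" and s: "s \<notin> \<int>\<^sub>\<le>\<^sub>0" and ls: "Re s < Re (2 * l)"
  shows "pochhammer l n / fact n * 4 ^ n *
           (Gamma (s + of_nat n) * Gamma (2 * l + 2 * of_nat n - (s + of_nat n)) / Gamma (2 * l + 2 * of_nat n)) =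
         Gamma s * Gamma (2 * l - s) / Gamma (2 * l) * fps_nth (fps_hypergeo [s, 2 * l - s] [l + 1 / 2] 1) n"
proof -
  have nonpos: "w \<notin> \<int>\<^sub>\<le>\<^sub>0" if "Re w > 0" for w using that by (auto elim!: nonpos_Ints_cases)
  have nz: "Gamma w \<noteq> 0" if "w \<notin> \<int>\<^sub>\<le>\<^sub>0" for w :: complex using that by (simp add: Gamma_eq_zero_iff)
  have G: "Gamma (w + of_nat m) = pochhammer w m * Gamma w" if "w \<notin> \<int>\<^sub>\<le>\<^sub>0" for w :: complex and m
    using pochhammer_Gamma[OF that, of m] nz[OF that] by simp
  have pz: "pochhammer w m \<noteq> 0" if "w \<notin> \<int>\<^sub>\<le>\<^sub>0" for w :: complex and m
    using that pochhammer_eq_0_imp_nonpos_Int by blast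
  have 1: "Gamma (s + of_nat n) = pochhammer s n * Gamma s" by (rule G[OF s])
  have e2: "2 * l + 2 * of_nat n - (s + of_nat n) = (2 * l - s) + of_nat n" by simp
  have 2: "Gamma (2 * l + 2 * of_nat n - (s + of_nat n)) = pochhammer (2 * l - s) n * Gamma (2 * l - s)"
    unfolding e2 using ls by (intro G nonpos) simp
  have e3: "2 * l + 2 * of_nat n = 2 * l + of_nat (2 * n)" by simp
  have 3: "Gamma (2 * l + 2 * of_nat n) = 4 ^ n * pochhammer l n * pochhammer (l + 1 / 2) n * Gamma (2 * l)"
    unfolding e3 using l by (subst G[OF nonpos]) (auto simp: pochhammer_double power_mult)
  show ?thesis
    unfolding 1 2 3 using pz[OF nonpos, of l n] pz[OF nonpos, of "l + 1 / 2" n] nz[OF nonpos, of "2 * l"] l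
    by (simp add: field_simps)
qed

lemma has_mellin_gegenbauer_remainder:
  fixes q :: nat and \<xi> :: real and l s :: complex
  assumes xi: "-1 < \<xi>" "\<xi> < 1" and l: "Re l > 0"
    and s: "- real q - 1 < Re s" "Re s < - real q"
  shows "has_mellin (gegenbauer_remainder q l \<xi>) s
           (- (Gamma s * Gamma (2 * l - s) / Gamma (2 * l) *
              hyp2F1 s (2 * l - s) (l + 1 / 2) (of_real ((1 - \<xi>) / 2))))"
proof -
  define z where "z = (1 - \<xi>) / 2"
  have z: "0 < z" "z < 1" using xi by (auto simp: z_def)
  define N where "N = Suc q"
  define c where "c = (\<lambda>n. pochhammer l n / fact n)"
  define b where "b = (\<lambda>n. c n * of_real (4 * z) ^ n)"
  define \<phi> where "\<phi> = (\<lambda>u. complex_of_real (1 + 2 * u * \<xi> + u\<^sup>2) powr (- l))"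
  \<comment> \<open>\<open>N - n\<close> is truncated: nothing is subtracted from the terms with \<open>n \<ge> N\<close>\<close>
  define R where "R = (\<lambda>n u. b n * of_real u ^ n * binomial_remainder (N - n) (2 * l + 2 * of_nat n) (of_real u))"
  define T where "T = (\<lambda>u. \<Sum>j<N. ((-1) ^ j * gegenbauer j l \<xi>) * complex_of_real u ^ j)"
  have geg: "gegenbauer_remainder q l \<xi> u = - (\<phi> u - T u)" for u
    unfolding gegenbauer_remainder_def \<phi>_def T_def N_def lessThan_Suc_atMost atMost_atLeast0
    by (simp add: power_minus[of "of_real u"] mult_ac)

  \<comment> \<open>The \<open>n\<close>-th term starts at \<open>u ^ n\<close>, so its Taylor
    polynomial takes only \<open>N - n\<close> terms of the binomial factor; \<open>d k\<close>
    collects all contributions to \<open>u ^ k\<close>.\<close>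
  define d where "d = (\<lambda>k. \<Sum>n\<le>k. b n * (- (2 * l + 2 * of_nat n) gchoose (k - n)))"
  define P where "P = (\<lambda>u. \<Sum>k<N. d k * complex_of_real u ^ k)"
  have R_sums: "(\<lambda>n. R n u) sums (\<phi> u - P u)" if u: "u > 0" for u
  proof -
    define p where "p = (\<lambda>n. b n * of_real u ^ n *
       (\<Sum>j<N - n. (- (2 * l + 2 * of_nat n) gchoose j) * complex_of_real u ^ j))"
    have "p sums (\<Sum>n<N. p n)" by (rule sums_finite) (auto simp: p_def)
    also have "(\<Sum>n<N. p n) = (\<Sum>(n, j)\<in>(SIGMA n:{..<N}. {..<N - n}).
        b n * (- (2 * l + 2 * of_nat n) gchoose j) * complex_of_real u ^ (n + j))"
      by (subst sum.Sigma[symmetric]) (auto simp: p_def sum_distrib_left power_add mult_ac intro!: sum.cong)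
    also have "(SIGMA n:{..<N}. {..<N - n}) = {(n, j). n + j < N}" by auto
    also have "(\<Sum>(n, j)\<in>{(n, j). n + j < N}.
        b n * (- (2 * l + 2 * of_nat n) gchoose j) * complex_of_real u ^ (n + j)) = P u"
      by (subst sum.triangle_reindex) (auto simp: P_def d_def sum_distrib_right intro!: sum.cong)
    finally have "p sums P u" .
    from sums_diff[OF gegenbauer_generating_expansion[OF xi u, of l, folded z_def] this]
    show ?thesis
      by (simp add: R_def p_def \<phi>_def b_def c_def binomial_remainder_def right_diff_distrib)
  qed

  \<comment> \<open>\<open>w\<close> consists of the absolute terms of the binomial series of
    \<open>(1 - z) powr (- l)\<close>; \<open>g\<close> retains the modulus factor
    \<open>(4 * u / (1 + u) ^ 2) ^ N\<close>, whose power \<open>u ^ N\<close> gives integrability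
    at 0.\<close>
  define w where "w = (\<lambda>n. norm (c n) * z ^ n)"
  define g where "g = (\<lambda>u. 4 ^ N * complex_of_real u ^ N * (1 + of_real u) powr (- (2 * l + 2 * of_nat N)))"
  have w: "summable w"
  proof -
    define y where "y = (1 + z) / 2"
    have y: "z < y" "0 < y" "y < 1" using z by (auto simp: y_def)
    have "(\<lambda>n. (- l gchoose n) * (- of_real y) ^ n) sums (1 + - complex_of_real y) powr (- l)"
      using y by (intro gen_binomial_complex) auto
    moreover have "(- l gchoose n) * (- of_real y) ^ n = c n * of_real y ^ n" for n
      by (simp add: gbinomial_pochhammer power_minus[of "of_real y"] c_def)
    ultimately have "summable (\<lambda>n. c n * of_real y ^ n)" by (auto simp: sums_iff)
    from powser_insidea[OF this, of "of_real z"] show ?thesis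
      using z y by (simp add: w_def norm_mult norm_power)
  qed
  have R_bound: "norm (R n u) \<le> w n * norm (g u)" if n: "n \<ge> N" and u: "u > 0" for n u
  proof -
    define x where "x = 4 * u / (1 + u)\<^sup>2"
    have "4 * u \<le> (1 + u)\<^sup>2" using sum_squares_ge_zero[of "1 - u" 0] by (simp add: power2_eq_square algebra_simps)
    then have x: "0 \<le> x" "x \<le> 1" using u by (auto simp: x_def field_simps)
    have powr_eq: "(1 + u) powr (- Re (2 * l + 2 * of_nat m)) = (1 + u) powr (- (2 * Re l)) / (1 + u) ^ (2 * m)" for m
      using u by (simp add: powr_diff flip: powr_realpow)
    have norm_eq: "norm ((1 + complex_of_real u) powr (- (2 * l + 2 * of_nat m))) =
        (1 + u) powr (- (2 * Re l)) / (1 + u) ^ (2 * m)" for m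
      using norm_of_real_powr[of "1 + u" "- (2 * l + 2 * of_nat m)"] powr_eq[of m] u by simp
    have x_eq: "4 ^ m * u ^ m / (1 + u) ^ (2 * m) = x ^ m" for m
      by (simp add: x_def power_divide power_mult_distrib power_mult)
    have "norm (R n u) = norm (c n) * z ^ n * (1 + u) powr (- (2 * Re l)) * (4 ^ n * u ^ n / (1 + u) ^ (2 * n))"
      using n u z norm_eq[of n]
      by (simp add: R_def b_def binomial_remainder_def norm_mult norm_power power_mult_distrib)
    also have "\<dots> = w n * (1 + u) powr (- (2 * Re l)) * x ^ n" by (simp only: x_eq w_def)
    \<comment> \<open>\<open>x \<le> 1\<close> permits lowering the exponent from \<open>n\<close>
      to \<open>N\<close>, so that the factor depending on \<open>u\<close> is the same for all
      \<open>n\<close>.\<close>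
    also have "\<dots> \<le> w n * (1 + u) powr (- (2 * Re l)) * x ^ N"
      using x n z by (intro mult_left_mono power_decreasing) (auto simp: w_def)
    also have "\<dots> = w n * norm (g u)"
      using u norm_eq[of N] by (simp add: g_def norm_mult norm_power flip: x_eq)
    finally show ?thesis .
  qed

  have PT: "P u = T u" for u
  proof -
    have "\<exists>M. summable M \<and> (\<forall>n u. u > 0 \<longrightarrow> norm (R n u) \<le> M n * u ^ N)"
    proof -
      have "\<forall>n. \<exists>C\<ge>0. \<forall>u\<ge>0. norm (binomial_remainder (N - n) (2 * l + 2 * of_nat n) (of_real u)) \<le> C * u ^ (N - n)"
        using l by (intro allI norm_binomial_remainder_le) auto
      then obtain C where C: "\<And>n u. u \<ge> 0 \<Longrightarrow>
          norm (binomial_remainder (N - n) (2 * l + 2 * of_nat n) (of_real u)) \<le> C n * u ^ (N - n)"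
        by metis
      \<comment> \<open>The first \<open>N\<close> terms use their own constants from
        \<open>norm_binomial_remainder_le\<close>; from \<open>N\<close> on the bound by
        \<open>g\<close> applies, with \<open>norm (g u) \<le> 4 ^ N * u ^ N\<close>.\<close>
      define M where "M = (\<lambda>n. if n < N then norm (b n) * C n else w n * 4 ^ N)"
      have "summable M"
        using summable_mult2[OF w, of "4 ^ N"]
        by (subst summable_cong[of _ "\<lambda>n. w n * 4 ^ N"])
          (auto simp: M_def eventually_sequentially intro!: exI[of _ N])
      moreover have "norm (R n u) \<le> M n * u ^ N" if u: "u > 0" for n u
      proof (cases "n < N")
        case True
        have "norm (R n u) = norm (b n) * u ^ n * norm (binomial_remainder (N - n) (2 * l + 2 * of_nat n) (of_real u))"
          using u by (simp add: R_def norm_mult norm_power)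
        also have "\<dots> \<le> norm (b n) * u ^ n * (C n * u ^ (N - n))"
          using C[of u n] u by (intro mult_left_mono) auto
        also have "\<dots> = norm (b n) * C n * (u ^ n * u ^ (N - n))" by simp
        also have "u ^ n * u ^ (N - n) = u ^ N" using True by (simp flip: power_add)
        finally show ?thesis using True by (simp add: M_def)
      next
        case False
        have "norm ((1 + complex_of_real u) powr (- (2 * l + 2 * of_nat N))) =
            (1 + u) powr (- (2 * Re l + 2 * real N))"
          using norm_of_real_powr[of "1 + u" "- (2 * l + 2 * of_nat N)"] u by simp
        also have "\<dots> \<le> (1 + u) powr 0" using u l by (intro powr_mono) auto
        finally have "norm (g u) \<le> 4 ^ N * u ^ N * 1"
          unfolding g_def using u by (simp add: norm_mult norm_power)
        then have "w n * norm (g u) \<le> w n * (4 ^ N * u ^ N)"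
          using z by (intro mult_left_mono) (auto simp: w_def)
        with R_bound[of n u] False u show ?thesis by (simp add: M_def)
      qed
      ultimately show ?thesis by blast
    qed
    then obtain M where M: "summable M" "\<And>n u. u > 0 \<Longrightarrow> norm (R n u) \<le> M n * u ^ N" by blast
    have P_bound: "norm (\<phi> u - P u) \<le> suminf M * u ^ N" if u: "u > 0" for u
    proof -
      have "norm (\<Sum>n. R n u) \<le> (\<Sum>n. M n * u ^ N)"
        using M u by (intro norm_suminf_le summable_mult2) auto
      also have "\<dots> = suminf M * u ^ N" by (rule suminf_mult2[OF M(1), symmetric])
      finally show ?thesis using R_sums[OF u] by (simp add: sums_iff)
    qed
    have "(\<lambda>k. ((-1) ^ k * gegenbauer k l \<xi>) * complex_of_real t ^ k) sums \<phi> t" if "0 < t" "t < 1" for t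
      using gegenbauer_sums[of \<xi> t l] xi that
      by (simp add: \<phi>_def power_minus[of "of_real t"] mult_ac)
    from norm_powser_tail_le[OF this, of N] obtain K
      where K: "\<And>t. 0 < t \<Longrightarrow> t \<le> 1 / 2 \<Longrightarrow> norm (\<phi> t - T t) \<le> K * t ^ N"
      unfolding T_def by blast
    have "d k - (-1) ^ k * gegenbauer k l \<xi> = 0" if "k < N" for k
    proof (rule poly_coeffs_zero_if_small[where d = "\<lambda>k. d k - (-1) ^ k * gegenbauer k l \<xi>"])
      fix u :: real assume u: "0 < u" "u \<le> 1 / 2"
      have "(\<Sum>k<N. (d k - (-1) ^ k * gegenbauer k l \<xi>) * of_real u ^ k) = P u - T u"
        by (simp add: P_def T_def left_diff_distrib sum_subtractf)
      also have "\<dots> = (\<phi> u - T u) - (\<phi> u - P u)" by simp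
      finally show "norm (\<Sum>k<N. (d k - (-1) ^ k * gegenbauer k l \<xi>) * of_real u ^ k) \<le> (K + suminf M) * u ^ N"
        using norm_triangle_ineq4[of "\<phi> u - T u" "\<phi> u - P u"] K[OF u] P_bound[OF u(1)]
        by (simp add: distrib_right)
    qed (use that in auto)
    then show ?thesis by (simp add: P_def T_def)
  qed

  define v where "v = (\<lambda>n. b n * (Gamma (s + of_nat n) *
     Gamma (2 * l + 2 * of_nat n - (s + of_nat n)) / Gamma (2 * l + 2 * of_nat n)))"
  \<comment> \<open>For \<open>n < N\<close> the point \<open>s + n\<close> lies in the strip
    belonging to \<open>N - n\<close> subtracted terms; for \<open>n \<ge> N\<close> its real part
    is positive and the plain Beta integral applies.\<close>
  have R: "has_mellin (R n) s (v n)" for n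
    unfolding R_def v_def using s l
    by (intro has_mellin_mult_power has_mellin_binomial_remainder) (auto simp: N_def)
  \<comment> \<open>The case without subtraction at \<open>s + N\<close>, whose real part lies
    between 0 and 1, shows that the dominating \<open>g\<close> has a Mellin transform.\<close>
  have "has_mellin (\<lambda>u. binomial_remainder 0 (2 * l + 2 * of_nat N) (of_real u)) (s + of_nat N)
     (Gamma (s + of_nat N) * Gamma (2 * l + 2 * of_nat N - (s + of_nat N)) / Gamma (2 * l + 2 * of_nat N))"
    using s l by (intro has_mellin_binomial_remainder) (auto simp: N_def)
  from has_mellin_mult_power[OF this, of "4 ^ N"] have g: "mellin_exists g s"
    by (simp add: has_mellin_iff g_def binomial_remainder_def)
  have main: "has_mellin (\<lambda>u. \<phi> u - T u) s (\<Sum>n. v n)"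
    by (rule has_mellin_suminf[OF R _ g w R_bound]) (use R_sums in \<open>simp_all add: PT\<close>)
  have s': "s \<notin> \<int>\<^sub>\<le>\<^sub>0" by (rule notin_nonpos_Ints_if_Re_between[of q]) (use s in auto)
  have l': "l + 1 / 2 \<notin> \<int>\<^sub>\<le>\<^sub>0" using l by (auto elim!: nonpos_Ints_cases dest: arg_cong[of _ _ Re])
  have "v n = Gamma s * Gamma (2 * l - s) / Gamma (2 * l) *
      (fps_nth (fps_hypergeo [s, 2 * l - s] [l + 1 / 2] 1) n * of_real z ^ n)" for n
  proof -
    have "v n = (pochhammer l n / fact n * 4 ^ n * (Gamma (s + of_nat n) *
       Gamma (2 * l + 2 * of_nat n - (s + of_nat n)) / Gamma (2 * l + 2 * of_nat n))) * of_real z ^ n"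
      by (simp add: v_def b_def c_def power_mult_distrib)
    also have "\<dots> = Gamma s * Gamma (2 * l - s) / Gamma (2 * l) *
        fps_nth (fps_hypergeo [s, 2 * l - s] [l + 1 / 2] 1) n * of_real z ^ n"
      using s l by (subst mellin_term_coeff[OF l s']) auto
    finally show ?thesis by (simp only: mult.assoc)
  qed
  then have "(\<Sum>n. v n) = Gamma s * Gamma (2 * l - s) / Gamma (2 * l) *
     hyp2F1 s (2 * l - s) (l + 1 / 2) (of_real z)"
    using suminf_mult[OF summable_hypergeo[OF l'], of "of_real z" "Gamma s * Gamma (2 * l - s) / Gamma (2 * l)" s "2 * l - s"] z
    unfolding hyp2F1_def eval_fps_def by simp
  with has_mellin_mult_power[of "\<lambda>u. \<phi> u - T u" s 0 _ "-1"] main show ?thesis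
    unfolding geg z_def[symmetric] by simp
qed

section \<open>From the hypergeometric function to the Legendre function\<close>

theorem mainTheorem1:
  fixes q :: nat and \<xi> :: real and l s :: complex
  assumes "-1 < \<xi>" and "\<xi> < 1"
    and "Re l > 0"
    and "- real q - 1 < Re s" and "Re s < - real q"
  shows "mellin_exists (gegenbauer_remainder q l \<xi>) s \<and>
    mellin (gegenbauer_remainder q l \<xi>) s =
      - (complex_of_real (sqrt pi) * Gamma s * Gamma (2 * l - s) /
           (2 powr (l - 1 / 2) * Gamma l)) *
        complex_of_real (1 - \<xi>\<^sup>2) powr ((1 - 2 * l) / 4) *
        legendreP (1 / 2 - l) (s - l - 1 / 2) \<xi>"
proof -
  define z where "z = complex_of_real ((1 - \<xi>) / 2)"
  define F where "F = hyp2F1 s (2 * l - s) (l + 1 / 2) z"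
  have nonpos: "w \<notin> \<int>\<^sub>\<le>\<^sub>0" if "Re w > 0" for w using that by (auto elim!: nonpos_Ints_cases)
  have l: "l \<notin> \<int>\<^sub>\<le>\<^sub>0" "l + 1 / 2 \<notin> \<int>\<^sub>\<le>\<^sub>0" "2 * l \<notin> \<int>\<^sub>\<le>\<^sub>0" using assms(3) by (auto intro!: nonpos)
  \<comment> \<open>All bases are positive reals, so each power is the exponential of a combination
    of these logarithms, and the identity between the powers becomes an identity of
    exponents.\<close>
  define x y where "x = complex_of_real (ln (1 + \<xi>))" and "y = complex_of_real (ln (1 - \<xi>))"
  define t where "t = complex_of_real (ln 2)"
  have powr_exp: "complex_of_real v powr w = exp (w * of_real (ln v))" if "v > 0" for v w
    using that by (simp add: powr_def Ln_of_real)
  have ln1: "ln ((1 + \<xi>) / (1 - \<xi>)) = ln (1 + \<xi>) - ln (1 - \<xi>)"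
    using assms by (simp add: ln_div)
  have "1 - \<xi>\<^sup>2 = (1 + \<xi>) * (1 - \<xi>)" by (simp add: power2_eq_square algebra_simps)
  then have ln2: "ln (1 - \<xi>\<^sup>2) = ln (1 + \<xi>) + ln (1 - \<xi>)" "1 - \<xi>\<^sup>2 > 0"
    using assms by (simp_all add: ln_mult)
  have ln3: "ln ((1 + \<xi>) / 2) = ln (1 + \<xi>) - ln 2" using assms by (simp add: ln_div)
  have 1: "complex_of_real (1 - \<xi>\<^sup>2) powr ((1 - 2 * l) / 4) = exp ((1 - 2 * l) / 4 * (x + y))"
    using powr_exp[OF ln2(2)] by (simp add: ln2(1) x_def y_def)
  have 2: "complex_of_real ((1 + \<xi>) / (1 - \<xi>)) powr ((1 / 2 - l) / 2) = exp ((1 / 2 - l) / 2 * (x - y))"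
    using powr_exp[of "(1 + \<xi>) / (1 - \<xi>)" "(1 / 2 - l) / 2"] assms by (simp add: ln1 x_def y_def)
  have 3: "(1 - z) powr (l - 1 / 2) = exp ((l - 1 / 2) * (x - t))"
  proof -
    have "1 - z = complex_of_real ((1 + \<xi>) / 2)" by (simp add: z_def field_simps)
    then show ?thesis using powr_exp[of "(1 + \<xi>) / 2" "l - 1 / 2"] assms by (simp only:) (simp add: ln3 x_def t_def)
  qed
  have 4: "2 powr (l - 1 / 2) = exp ((l - 1 / 2) * t)"
    using powr_exp[of 2 "l - 1 / 2"] by (simp add: t_def)
  have "hyp2F1 (- (s - l - 1 / 2)) (s - l - 1 / 2 + 1) (1 - (1 / 2 - l)) z =
        hyp2F1 (l + 1 / 2 - s) (s - l + 1 / 2) (l + 1 / 2) z"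
    by (simp add: algebra_simps)
  \<comment> \<open>For the Legendre parameters, \<open>c - a = s\<close>,
    \<open>c - b = 2 * l - s\<close> and \<open>c - a - b = l - 1 / 2\<close> in Euler's
    transformation.\<close>
  also have "\<dots> = (1 - z) powr (l - 1 / 2) * F"
  proof -
    have "norm z < 1" using assms unfolding z_def norm_of_real by simp
    from euler_transformation[OF l(2) this, of "l + 1 / 2 - s" "s - l + 1 / 2"] show ?thesis
      by (simp add: F_def algebra_simps)
  qed
  finally have P: "legendreP (1 / 2 - l) (s - l - 1 / 2) \<xi> =
     1 / Gamma (l + 1 / 2) * exp ((1 / 2 - l) / 2 * (x - y)) * (exp ((l - 1 / 2) * (x - t)) * F)"
    unfolding legendreP_def 2 z_def[symmetric] 3 by (simp add: algebra_simps)
  \<comment> \<open>The duplication formula links \<open>Gamma (2 * l)\<close> of the termwise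
    transform with \<open>Gamma l\<close> of the claim and \<open>Gamma (l + 1 / 2)\<close> of the
    Legendre normalisation.\<close>
  have G: "Gamma l * Gamma (l + 1 / 2) = exp ((1 - 2 * l) * t) * of_real (sqrt pi) * Gamma (2 * l)"
    unfolding t_def by (rule Gamma_legendre_duplication[OF l(1,2)])
  have nz: "Gamma l \<noteq> 0" "Gamma (l + 1 / 2) \<noteq> 0" "Gamma (2 * l) \<noteq> 0"
    using l by (simp_all add: Gamma_eq_zero_iff)
  \<comment> \<open>The multiples of \<open>x\<close> and \<open>y\<close> cancel; what remains is
    the power of 2 in the duplication formula.\<close>
  have E: "exp ((1 - 2 * l) / 4 * (x + y)) * exp ((1 / 2 - l) / 2 * (x - y)) * exp ((l - 1 / 2) * (x - t)) /
     exp ((l - 1 / 2) * t) = exp ((1 - 2 * l) * t)"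
  proof -
    have "(1 - 2 * l) / 4 * (x + y) + (1 / 2 - l) / 2 * (x - y) + (l - 1 / 2) * (x - t) - (l - 1 / 2) * t =
        (1 - 2 * l) * t"
      by (simp add: field_simps)
    then show ?thesis by (simp only: flip: exp_add exp_diff)
  qed
  have "- (complex_of_real (sqrt pi) * Gamma s * Gamma (2 * l - s) /
           (2 powr (l - 1 / 2) * Gamma l)) *
        complex_of_real (1 - \<xi>\<^sup>2) powr ((1 - 2 * l) / 4) *
        legendreP (1 / 2 - l) (s - l - 1 / 2) \<xi> =
     - (Gamma s * Gamma (2 * l - s) * F) * ((exp ((1 - 2 * l) / 4 * (x + y)) *
        exp ((1 / 2 - l) / 2 * (x - y)) * exp ((l - 1 / 2) * (x - t)) / exp ((l - 1 / 2) * t)) *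
        of_real (sqrt pi) / (Gamma l * Gamma (l + 1 / 2)))"
    unfolding P 1 4 using nz by (simp add: mult_ac)
  also have "\<dots> = - (Gamma s * Gamma (2 * l - s) / Gamma (2 * l) * F)"
    unfolding E G using nz by simp
  finally show ?thesis
    using has_mellin_gegenbauer_remainder[OF assms]
    by (simp add: has_mellin_iff F_def z_def)
qed

end
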